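(* Let $k\ge2$, $n=2k$, $m=2k-1$, and consider the words $P=(h_0,h_1,u_0,u_1,l_0,l_1)\in\{M,V\}^6$ with $\delta_0=\delta_1=-1$ and $\tau=+1$, where (with $M=+1$, $V=-1$) $\rho=h_0h_1$, $\tau=u_0u_1$, $\delta_i=h_0h_1u_il_i$. (i) If $\rho=+1$, the four such words are $MMMMVV$, $MMVVMM$, $VVMMVV$, $VVVVMM$, and their exact state sets are respectively $F(MMMMVV,k)$, $T_R(F(MMMMVV,k))$, $T_{CR}(F(MMMMVV,k))$, $T_C(F(MMMMVV,k))$. For $(\alpha,\beta)\in\{1,\dots,m\}^2$, there is a state in $F(P,k)$ with pivot pair $(\alpha,\beta)$ if and only if: $\alpha=1$ or $\alpha=m$ or $\alpha=\beta$, when $P\in\{MMMMVV,VVVVMM\}$; $\beta=1$ or $\beta=m$ or $\alpha=\beta$, when $P\in\{MMVVMM,VVMMVV\}$ (the maps $T_R$ and $T_{CR}$ exchange the ordered pivots). (ii) If $\rho=-1$, the four such words are $MVMMMM$, $VMMMMM$, $VMVVVV$, $MVVVVV$, and their exact state sets are respectively $F(MVMMMM,k)$, $T_H(F(MVMMMM,k))$, $T_C(F(MVMMMM,k))$, $T_{CH}(F(MVMMMM,k))$. For $(\alpha,\beta)\in\{1,\dots,m\}^2$, there is a state in $F(P,k)$ with pivot pair $(\alpha,\beta)$ if and only if: $B_R(\alpha)=B_R(\beta)$, when $P\in\{MVMMMM,VMVVVV\}$; $B_L(\alpha)=B_L(\beta)$, when $P\in\{VMMMMM,MVVVVV\}$.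 In the latter case a source state in $F(MVMMMM,k)$ with pivot pair $(a,b)$ is sent by $T_H$, respectively $T_{CH}$, to a state with pivot pair $(\alpha,\beta)=(n-a,n-b)$. In all cases, for every compatible pair $(\alpha,\beta)$ there is exactly one state in $F(P,k)$ with pivot pair $(\alpha,\beta)$.
   Context: Map and assignment. Let $k\ge2$, $n=2k$. The upper faces are $A_1,\dots,A_n$, the lower faces $B_1,\dots,B_n$. The creases are $H_c=(A_c,B_c)$ ($1\le c\le n$), $U_i=(A_i,A_{i+1})$ and $L_i=(B_i,B_{i+1})$ ($1\le i\le n-1$); the two faces of a crease are its wings. A word $P=(h_0,h_1,u_0,u_1,l_0,l_1)\in\{M,V\}^6$ (written as a six-letter string) assigns to $H_c$ the label $h_{(c-1)\bmod 2}$ and to $U_i,L_i$ the labels $u_{(i-1)\bmod2},l_{(i-1)\bmod2}$. The assignment is locally flat-foldable if for every $1\le c\le n-1$ an odd number of the four creases $H_c,H_{c+1},U_c,L_c$ (meeting at an interior vertex) are labelled $M$. States. $x\prec y$ means $x$ lies above (comes before) $y$ in a total order. A strict total order of all $4k$ labelled faces is order-valid for $P$ if: (i) Precedence: with $A_c$ in row $r=0$ and $B_c$ in row $r=1$, the face in row $r$, column $c$ is light-up iff $r+c-1$ is even and dark-up otherwise; across each $M$ crease the light-up wing precedes the dark-up wing, across each $V$ crease the dark-up wing precedes the light-up wing. (ii) Noncrossing: every $H_c$ has target class $S$; $U_i$ and $L_i$ have class $E$ for $i$ odd and $W$ for $i$ even; for any two distinct creases of the same target class with disjoint wing sets, with wing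 positions $a_0<a_1$ and $b_0<b_1$ in the order, neither $a_0<b_0<a_1<b_1$ nor $b_0<a_0<b_1<a_1$. $F(P,k)$ is the set of all order-valid strict total orders if $P$ is locally flat-foldable, and $F(P,k)=\varnothing$ otherwise. Symmetry maps. $\phi_R$ exchanges $A_c$ and $B_c$ for all $c$; $\phi_H(A_c)=A_{n+1-c}$, $\phi_H(B_c)=B_{n+1-c}$. For a total order $\Pi$, $\phi(\Pi)$ is elementwise relabelling and $\operatorname{rev}(\Pi)$ reversal. $T_C(\Pi)=\operatorname{rev}(\Pi)$, $T_R(\Pi)=\operatorname{rev}(\phi_R(\Pi))$, $T_H(\Pi)=\operatorname{rev}(\phi_H(\Pi))$, $T_{CR}(\Pi)=\phi_R(\Pi)$, $T_{CH}(\Pi)=\phi_H(\Pi)$; applied to sets elementwise. Pivots. Write $O_i=2i-1$, $D_i=2i$ for $1\le i\le k$. For $1\le p\le 2k-1$ define the column word $W_p$ by $W_{2s-1}=(O_s,O_{s-1},\dots,O_1,D_1,\dots,D_{s-1},O_{s+1},\dots,O_k,D_k,\dots,D_{s+1},D_s)$ and $W_{2s}=(O_{s+1},\dots,O_k,D_k,\dots,D_{s+1},O_s,\dots,O_1,D_1,\dots,D_s)$, empty blocks omitted. The first and last entries of $W_p$ are the columns $p,p+1$ in some order. A total order of the faces has pivot pair $(\alpha,\beta)$ if its restriction to the upper faces has column sequence $W_\alpha$ or $\operatorname{rev}(W_\alpha)$ and its restriction to the lower faces has column sequence $W_\beta$ or $\operatorname{rev}(W_\beta)$. Block coordinates. $B_R(1)=0$,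 $B_R(p)=\lfloor p/2\rfloor$ for $p\ge2$; $B_L(p)=B_R(n-p)$ for $1\le p\le m$. *)

theory Defs
  imports Main
begin

datatype mv = M | V

text \<open>The word \<open>(h\<^sub>0, h\<^sub>1, u\<^sub>0, u\<^sub>1, l\<^sub>0, l\<^sub>1)\<close>.\<close>
type_synonym word = "mv \<times> mv \<times> mv \<times> mv \<times> mv \<times> mv"

text \<open>Columns are numbered from 1 to \<open>2 * k\<close>.\<close>
datatype face = A nat | B nat

datatype crease = H nat | U nat | L nat

definition faces :: "nat \<Rightarrow> face set" where
  "faces k = A ` {1..2 * k} \<union> B ` {1..2 * k}"

definition creases :: "nat \<Rightarrow> crease set" where
  "creases k = H ` {1..2 * k} \<union> U ` {1..2 * k - 1} \<union> L ` {1..2 * k - 1}"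

fun wings :: "crease \<Rightarrow> face set" where
  "wings (H c) = {A c, B c}"
| "wings (U i) = {A i, A (i + 1)}"
| "wings (L i) = {B i, B (i + 1)}"

fun label :: "word \<Rightarrow> crease \<Rightarrow> mv" where
  "label (h0, h1, u0, u1, l0, l1) (H c) = (if (c - 1) mod 2 = 0 then h0 else h1)"
| "label (h0, h1, u0, u1, l0, l1) (U i) = (if (i - 1) mod 2 = 0 then u0 else u1)"
| "label (h0, h1, u0, u1, l0, l1) (L i) = (if (i - 1) mod 2 = 0 then l0 else l1)"

definition locally_flat_foldable :: "word \<Rightarrow> nat \<Rightarrow> bool" where
  "locally_flat_foldable P k \<longleftrightarrow>
     (\<forall>c\<in>{1..2 * k - 1}. odd (card {x \<in> {H c, H (c + 1), U c, L c}. label P x = M}))"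

fun light_up :: "face \<Rightarrow> bool" where
  "light_up (A c) \<longleftrightarrow> even (0 + c - 1)"
| "light_up (B c) \<longleftrightarrow> even (1 + c - 1)"

datatype target = S | E | W

fun target_class :: "crease \<Rightarrow> target" where
  "target_class (H c) = S"
| "target_class (U i) = (if odd i then E else W)"
| "target_class (L i) = (if odd i then E else W)"

text \<open>A state is a relation \<open>\<Pi>\<close>, with \<open>(x, y) \<in> \<Pi>\<close> meaning that \<open>x\<close> lies above (comes before) \<open>y\<close>.
  Since \<open>strict_linear_order_on\<close> does not confine the relation to the given set, this is
  required separately; hence equality of relations is equality of orders on the faces.\<close>
definition face_order :: "nat \<Rightarrow> face rel \<Rightarrow> bool" where
  "face_order k \<Pi> \<longleftrightarrow> \<Pi> \<subseteq> faces k \<times> faces k \<and> strict_linear_order_on (faces k) \<Pi>"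

definition precedence :: "word \<Rightarrow> nat \<Rightarrow> face rel \<Rightarrow> bool" where
  "precedence P k \<Pi> \<longleftrightarrow>
     (\<forall>x\<in>creases k. \<forall>f\<in>wings x. \<forall>g\<in>wings x. light_up f \<and> \<not> light_up g \<longrightarrow>
        (label P x = M \<longrightarrow> (f, g) \<in> \<Pi>) \<and> (label P x = V \<longrightarrow> (g, f) \<in> \<Pi>))"

definition noncrossing :: "nat \<Rightarrow> face rel \<Rightarrow> bool" where
  "noncrossing k \<Pi> \<longleftrightarrow>
     (\<forall>x\<in>creases k. \<forall>y\<in>creases k.
        x \<noteq> y \<and> target_class x = target_class y \<and> wings x \<inter> wings y = {} \<longrightarrow>
        (\<forall>a0 a1 b0 b1.
           wings x = {a0, a1} \<and> (a0, a1) \<in> \<Pi> \<and> wings y = {b0, b1} \<and> (b0, b1) \<in> \<Pi> \<longrightarrow>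
           \<not> ((a0, b0) \<in> \<Pi> \<and> (b0, a1) \<in> \<Pi> \<and> (a1, b1) \<in> \<Pi>) \<and>
           \<not> ((b0, a0) \<in> \<Pi> \<and> (a0, b1) \<in> \<Pi> \<and> (b1, a1) \<in> \<Pi>)))"

definition order_valid :: "word \<Rightarrow> nat \<Rightarrow> face rel \<Rightarrow> bool" where
  "order_valid P k \<Pi> \<longleftrightarrow> face_order k \<Pi> \<and> precedence P k \<Pi> \<and> noncrossing k \<Pi>"

definition F :: "word \<Rightarrow> nat \<Rightarrow> face rel set" where
  "F P k = (if locally_flat_foldable P k then {\<Pi>. order_valid P k \<Pi>} else {})"

fun phi_R :: "face \<Rightarrow> face" where
  "phi_R (A c) = B c"
| "phi_R (B c) = A c"

fun phi_H :: "nat \<Rightarrow> face \<Rightarrow> face" where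
  "phi_H k (A c) = A (2 * k + 1 - c)"
| "phi_H k (B c) = B (2 * k + 1 - c)"

definition relabel :: "(face \<Rightarrow> face) \<Rightarrow> face rel \<Rightarrow> face rel" where
  "relabel \<phi> \<Pi> = map_prod \<phi> \<phi> ` \<Pi>"

definition T_C :: "face rel \<Rightarrow> face rel" where
  "T_C \<Pi> = \<Pi>\<inverse>"

definition T_R :: "face rel \<Rightarrow> face rel" where
  "T_R \<Pi> = (relabel phi_R \<Pi>)\<inverse>"

definition T_H :: "nat \<Rightarrow> face rel \<Rightarrow> face rel" where
  "T_H k \<Pi> = (relabel (phi_H k) \<Pi>)\<inverse>"

definition T_CR :: "face rel \<Rightarrow> face rel" where
  "T_CR \<Pi> = relabel phi_R \<Pi>"

definition T_CH :: "nat \<Rightarrow> face rel \<Rightarrow> face rel" where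
  "T_CH k \<Pi> = relabel (phi_H k) \<Pi>"

definition odd_col :: "nat \<Rightarrow> nat" where
  "odd_col i = 2 * i - 1"

definition even_col :: "nat \<Rightarrow> nat" where
  "even_col i = 2 * i"

text \<open>The word \<open>W\<^sub>p\<close>, for \<open>1 \<le> p \<le> 2 * k - 1\<close>; the two branches are \<open>p = 2 * s - 1\<close> and \<open>p = 2 * s\<close>.\<close>
definition column_word :: "nat \<Rightarrow> nat \<Rightarrow> nat list" where
  "column_word k p =
     (if odd p then
        (let s = (p + 1) div 2 in
           map odd_col (rev [1..<s + 1]) @ map even_col [1..<s] @
           map odd_col [s + 1..<k + 1] @ map even_col (rev [s..<k + 1]))
      else
        (let s = p div 2 in
           map odd_col [s + 1..<k + 1] @ map even_col (rev [s + 1..<k + 1]) @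
           map odd_col (rev [1..<s + 1]) @ map even_col [1..<s + 1]))"

text \<open>The strict order in which the entries of a duplicate-free list appear.\<close>
definition list_order :: "'a list \<Rightarrow> 'a rel" where
  "list_order xs = {(xs ! i, xs ! j) | i j. i < j \<and> j < length xs}"

text \<open>Here \<open>row\<close> is \<open>A\<close> or \<open>B\<close>.\<close>
definition has_column_sequence :: "nat \<Rightarrow> (nat \<Rightarrow> face) \<Rightarrow> face rel \<Rightarrow> nat list \<Rightarrow> bool" where
  "has_column_sequence k row \<Pi> w \<longleftrightarrow>
     \<Pi> \<inter> (row ` {1..2 * k} \<times> row ` {1..2 * k}) = list_order (map row w)"

definition has_pivot_pair :: "nat \<Rightarrow> face rel \<Rightarrow> nat \<Rightarrow> nat \<Rightarrow> bool" where
  "has_pivot_pair k \<Pi> \<alpha> \<beta> \<longleftrightarrow>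
     (has_column_sequence k A \<Pi> (column_word k \<alpha>) \<or>
      has_column_sequence k A \<Pi> (rev (column_word k \<alpha>))) \<and>
     (has_column_sequence k B \<Pi> (column_word k \<beta>) \<or>
      has_column_sequence k B \<Pi> (rev (column_word k \<beta>)))"

definition B_R :: "nat \<Rightarrow> nat" where
  "B_R p = (if p = 1 then 0 else p div 2)"

definition B_L :: "nat \<Rightarrow> nat \<Rightarrow> nat" where
  "B_L k p = B_R (2 * k - p)"

fun sign :: "mv \<Rightarrow> int" where
  "sign M = 1"
| "sign V = - 1"

fun rho :: "word \<Rightarrow> int" where
  "rho (h0, h1, u0, u1, l0, l1) = sign h0 * sign h1"

fun tau :: "word \<Rightarrow> int" where
  "tau (h0, h1, u0, u1, l0, l1) = sign u0 * sign u1"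

fun delta0 :: "word \<Rightarrow> int" where
  "delta0 (h0, h1, u0, u1, l0, l1) = sign h0 * sign h1 * sign u0 * sign l0"

fun delta1 :: "word \<Rightarrow> int" where
  "delta1 (h0, h1, u0, u1, l0, l1) = sign h0 * sign h1 * sign u1 * sign l1"

end

theory Submission
  imports Defs
begin

text \<open>The word \<open>W\<^sub>p\<close> sorts the columns by an explicit integer rank. Precedence forces the upper
  faces to follow \<open>W\<^sub>\<alpha>\<close>, and the lower faces to follow \<open>W\<^sub>\<beta>\<close> for \<open>MMMMVV\<close> and its reversal
  for \<open>MVMMMM\<close>. Noncrossing of the hinges \<open>H\<^sub>c\<close> and of the pairs \<open>U\<^sub>c\<close>, \<open>L\<^sub>d\<close> then fixes the relative
  position of every upper and every lower face, so a state is determined by its pivot pair.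
  Incompatible pairs are refuted by two columns whose order in the two words leads to a cycle, and
  for compatible pairs the state is written down through an integer key for the faces; all the
  required inequalities are linear. Reversal, row exchange and column reflection carry the two base
  words to the other six, and column reflection also turns \<open>\<alpha> = 1\<close> into \<open>\<alpha> = 2k - 1\<close>.\<close>

section \<open>Ranks of columns\<close>

text \<open>The compatibility conditions can be read off the words. In a state of
  \<open>MMMMVV\<close>, an even column d ahead of an odd column c in the upper word yields
  \<open>B d\<close>, \<open>A d\<close>, \<open>A c\<close>, \<open>B c\<close> in this order, so
  the lower word must also have d before c. In \<open>W\<^sub>1\<close> and in the word of pivot 2k
  - 1 every odd column precedes every even one, and nothing is passed on. For any other \<alpha> the
  two blocks of \<open>W\<^sub>\<alpha>\<close> meet in an even column followed by an odd one, and
  no other word has this pair in this order; hence \<alpha> = \<beta>. In a state of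
  \<open>MVMMMM\<close> every hinge runs from the upper to the lower face, and the lower word runs
  backwards. The column \<open>2 * B_R p + 1\<close> is the first one of \<open>W\<^sub>p\<close>,
  so a class of \<open>B_R\<close> collects the pivots with a common first column. Two different
  first columns would have hinges that are disjoint as intervals, and their right neighbours would
  then be in the wrong order. The directions of the hinges also explain the two uniqueness
  arguments: if all agree, hinges alone place every upper face among the lower ones; if they
  alternate, hinges compare columns of equal parity and the creases of the rows supply the
  rest.\<close>

text \<open>The columns up to \<open>p\<close> appear in \<open>W\<^sub>p\<close> as odd descending, even ascending, and the columns beyond
  \<open>p\<close> as odd ascending, even descending. The first block precedes the second iff \<open>p\<close> is odd,
  whence the shift by \<open>4k\<close>.\<close>

definition rank :: "nat \<Rightarrow> nat \<Rightarrow> nat \<Rightarrow> int" where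
  "rank k p c =
     (if c \<le> p then (if odd p then 0 else 4 * int k) + (if odd c then - int c else int c)
      else if odd c then int c else 4 * int k - int c)"

lemma list_order_sorted:
  assumes "sorted_wrt (\<lambda>x y. f x < (f y :: int)) xs"
  shows "list_order xs = {(x, y). x \<in> set xs \<and> y \<in> set xs \<and> f x < f y}"
proof -
  have mono: "f (xs ! i) < f (xs ! j)" if "i < j" "j < length xs" for i j
    using assms that by (simp add: sorted_wrt_iff_nth_less)
  show ?thesis
  proof (intro set_eqI iffI)
    fix z assume "z \<in> list_order xs"
    then obtain i j where "z = (xs ! i, xs ! j)" "i < j" "j < length xs"
      by (auto simp: list_order_def)
    then show "z \<in> {(x, y). x \<in> set xs \<and> y \<in> set xs \<and> f x < f y}"
      using mono by auto
  next
    fix z assume "z \<in> {(x, y). x \<in> set xs \<and> y \<in> set xs \<and> f x < f y}"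
    then obtain i j where z: "z = (xs ! i, xs ! j)" "i < length xs" "j < length xs"
      "f (xs ! i) < f (xs ! j)"
      by (auto simp: in_set_conv_nth)
    then have "i < j"
      using mono[of j i] by (cases i j rule: linorder_cases) auto
    then show "z \<in> list_order xs"
      using z by (auto simp: list_order_def)
  qed
qed

lemma set_column_word:
  assumes "p \<in> {1..2 * k - 1}"
  shows "set (column_word k p) = {1..2 * k}"
proof -
  have "set (column_word k p) = odd_col ` {1..<k + 1} \<union> even_col ` {1..<k + 1}"
  proof (cases "odd p")
    case True
    define s where "s = (p + 1) div 2"
    have "{1..<s + 1} \<union> {s + 1..<k + 1} = {1..<k + 1}" "{1..<s} \<union> {s..<k + 1} = {1..<k + 1}"
      using assms True by (auto simp: s_def)
    then show ?thesis
      using True unfolding column_word_def Let_def s_def[symmetric]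
      by (simp del: upt_Suc add: image_Un[symmetric] Un_ac) (simp add: image_Un[symmetric] Un_assoc[symmetric])
  next
    case False
    define s where "s = p div 2"
    have "{s + 1..<k + 1} \<union> {1..<s + 1} = {1..<k + 1}"
      using assms False by (auto simp: s_def)
    then show ?thesis
      using False unfolding column_word_def Let_def s_def[symmetric]
      by (simp del: upt_Suc add: image_Un[symmetric] Un_ac) (simp add: image_Un[symmetric] Un_assoc[symmetric])
  qed
  also have "\<dots> = {1..2 * k}"
  proof (intro subset_antisym subsetI)
    fix c assume c: "c \<in> {1..2 * k}"
    show "c \<in> odd_col ` {1..<k + 1} \<union> even_col ` {1..<k + 1}"
    proof (cases "odd c")
      case True
      then obtain i where "c = 2 * i + 1" by (elim oddE)
      then have "c = odd_col (i + 1)" "i + 1 \<in> {1..<k + 1}"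
        using c by (auto simp: odd_col_def)
      then show ?thesis by blast
    next
      case False
      then obtain i where "c = 2 * i" by auto
      then have "c = even_col i" "i \<in> {1..<k + 1}"
        using c by (auto simp: even_col_def)
      then show ?thesis by blast
    qed
  qed (auto simp: odd_col_def even_col_def)
  finally show ?thesis .
qed

lemma sorted_wrt_upt_iff:
  "sorted_wrt P [a..<b] \<longleftrightarrow> (\<forall>i j. a \<le> i \<longrightarrow> i < j \<longrightarrow> j < b \<longrightarrow> P i j)"
proof
  assume l: "sorted_wrt P [a..<b]"
  show "\<forall>i j. a \<le> i \<longrightarrow> i < j \<longrightarrow> j < b \<longrightarrow> P i j"
  proof (intro allI impI)
    fix i j assume "a \<le> i" "i < j" "j < b"
    then show "P i j"
      using sorted_wrt_nth_less[OF l, of "i - a" "j - a"] by simp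
  qed
qed (simp add: sorted_wrt_iff_nth_less)

lemma sorted_column_word:
  assumes "p \<in> {1..2 * k - 1}"
  shows "sorted_wrt (\<lambda>c d. rank k p c < rank k p d) (column_word k p)"
proof (cases "odd p")
  case True
  \<comment> \<open>This \<open>s\<close> is one less than the parameter of the word, which is
    \<open>(p + 1) div 2 = s + 1\<close>.\<close>
  then obtain s where p: "p = 2 * s + 1" by (elim oddE)
  have *: "(p + 1) div 2 = s + 1" "s + 1 \<le> k" using p assms by auto
  show ?thesis
    using True *(2) unfolding column_word_def Let_def *(1)
    by (auto simp: sorted_wrt_append sorted_wrt_map sorted_wrt_rev odd_col_def even_col_def
        sorted_wrt_upt_iff rank_def p simp del: upt_Suc)
next
  case False
  then obtain s where p: "p = 2 * s" by auto
  have *: "p div 2 = s" "s + 1 \<le> k" "1 \<le> s" using p assms by auto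
  show ?thesis
    using False *(2,3) unfolding column_word_def Let_def *(1)
    by (auto simp: sorted_wrt_append sorted_wrt_map sorted_wrt_rev odd_col_def even_col_def
        sorted_wrt_upt_iff rank_def p simp del: upt_Suc)
qed

text \<open>Comparing by a key instead of a list turns reversal of a word into negation of
  \<open>f\<close>, and reflection of the columns into a substitution in \<open>f\<close>.\<close>

definition row_sorted :: "nat \<Rightarrow> (nat \<Rightarrow> face) \<Rightarrow> face rel \<Rightarrow> (nat \<Rightarrow> int) \<Rightarrow> bool" where
  "row_sorted k row \<Pi> f \<longleftrightarrow>
     (\<forall>c\<in>{1..2 * k}. \<forall>d\<in>{1..2 * k}. (row c, row d) \<in> \<Pi> \<longleftrightarrow> f c < f d)"

lemma has_column_sequence_iff_row_sorted:
  assumes "inj row" and "set w = {1..2 * k}" and "sorted_wrt (\<lambda>c d. f c < f d) w"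
  shows "has_column_sequence k row \<Pi> w \<longleftrightarrow> row_sorted k row \<Pi> f"
proof -
  let ?X = "{1..2 * k}"
  have "sorted_wrt (\<lambda>x y. f (inv row x) < f (inv row y)) (map row w)"
    using assms by (simp add: sorted_wrt_map)
  note order = list_order_sorted[OF this]
  have mem: "(row c, row d) \<in> list_order (map row w) \<longleftrightarrow> c \<in> ?X \<and> d \<in> ?X \<and> f c < f d" for c d
    using assms(1,2) by (simp add: order inj_image_mem_iff)
  have sub: "list_order (map row w) \<subseteq> row ` ?X \<times> row ` ?X"
    using assms(2) by (auto simp: order)
  show ?thesis
  proof
    assume "has_column_sequence k row \<Pi> w"
    then have "(row c, row d) \<in> \<Pi> \<longleftrightarrow> (row c, row d) \<in> list_order (map row w)"
      if "c \<in> ?X" "d \<in> ?X" for c d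
      using that unfolding has_column_sequence_def by blast
    then show "row_sorted k row \<Pi> f"
      by (simp add: row_sorted_def mem)
  next
    assume r: "row_sorted k row \<Pi> f"
    have "z \<in> \<Pi> \<longleftrightarrow> z \<in> list_order (map row w)" if z: "z \<in> row ` ?X \<times> row ` ?X" for z
    proof -
      obtain c d where "z = (row c, row d)" "c \<in> ?X" "d \<in> ?X" using z by blast
      then show ?thesis using r by (simp add: row_sorted_def mem)
    qed
    then show "has_column_sequence k row \<Pi> w"
      using sub unfolding has_column_sequence_def by blast
  qed
qed

lemma column_sequence_iff_rank:
  assumes "inj row" and "p \<in> {1..2 * k - 1}"
  shows "has_column_sequence k row \<Pi> (column_word k p) \<longleftrightarrow> row_sorted k row \<Pi> (rank k p)"
    and "has_column_sequence k row \<Pi> (rev (column_word k p)) \<longleftrightarrow>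
      row_sorted k row \<Pi> (\<lambda>c. - rank k p c)"
  using assms by (simp_all add: has_column_sequence_iff_row_sorted set_column_word
      sorted_column_word sorted_wrt_rev)

lemma has_pivot_pair_iff:
  assumes "\<alpha> \<in> {1..2 * k - 1}" and "\<beta> \<in> {1..2 * k - 1}"
  shows "has_pivot_pair k \<Pi> \<alpha> \<beta> \<longleftrightarrow>
    (row_sorted k A \<Pi> (rank k \<alpha>) \<or> row_sorted k A \<Pi> (\<lambda>c. - rank k \<alpha> c)) \<and>
    (row_sorted k B \<Pi> (rank k \<beta>) \<or> row_sorted k B \<Pi> (\<lambda>c. - rank k \<beta> c))"
  using assms by (simp add: has_pivot_pair_def column_sequence_iff_rank inj_def)

section \<open>Creases as intervals between a top and a bottom wing\<close>

fun light_wing :: "crease \<Rightarrow> face" where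
  "light_wing (H c) = (if odd c then A c else B c)"
| "light_wing (U i) = (if odd i then A i else A (i + 1))"
| "light_wing (L i) = (if odd i then B (i + 1) else B i)"

fun dark_wing :: "crease \<Rightarrow> face" where
  "dark_wing (H c) = (if odd c then B c else A c)"
| "dark_wing (U i) = (if odd i then A (i + 1) else A i)"
| "dark_wing (L i) = (if odd i then B i else B (i + 1))"

text \<open>The wing that precedence puts first.\<close>

definition top_wing :: "word \<Rightarrow> crease \<Rightarrow> face" where
  "top_wing P x = (if label P x = M then light_wing x else dark_wing x)"

definition bottom_wing :: "word \<Rightarrow> crease \<Rightarrow> face" where
  "bottom_wing P x = (if label P x = M then dark_wing x else light_wing x)"

lemma wings_light_dark:
  assumes "x \<in> creases k"
  shows "wings x = {light_wing x, dark_wing x}"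
    and "light_up (light_wing x)" and "\<not> light_up (dark_wing x)"
    and "light_wing x \<in> faces k" and "dark_wing x \<in> faces k"
  using assms by (auto simp: creases_def faces_def split: if_splits)

lemma wings_top_bottom:
  assumes "x \<in> creases k"
  shows "wings x = {top_wing P x, bottom_wing P x}"
    and "top_wing P x \<in> faces k" and "bottom_wing P x \<in> faces k"
  using wings_light_dark[OF assms] by (auto simp: top_wing_def bottom_wing_def)

lemma face_order_iff:
  "face_order k \<Pi> \<longleftrightarrow> \<Pi> \<subseteq> faces k \<times> faces k \<and> trans \<Pi> \<and> irrefl \<Pi> \<and>
     (\<forall>x\<in>faces k. \<forall>y\<in>faces k. x \<noteq> y \<longrightarrow> (x, y) \<in> \<Pi> \<or> (y, x) \<in> \<Pi>)"
  by (auto simp: face_order_def strict_linear_order_on_def total_on_def)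

text \<open>Precedence fixes which wing of each crease comes first, so the quantified wing positions
  collapse to top and bottom wings. Of the two crossing patterns one is enough, because the other
  arises by exchanging x and y.\<close>

lemma order_valid_iff:
  assumes "face_order k \<Pi>"
  shows "order_valid P k \<Pi> \<longleftrightarrow>
    (\<forall>x\<in>creases k. (top_wing P x, bottom_wing P x) \<in> \<Pi>) \<and>
    (\<forall>x\<in>creases k. \<forall>y\<in>creases k.
       x \<noteq> y \<and> target_class x = target_class y \<and> wings x \<inter> wings y = {} \<longrightarrow>
       \<not> ((top_wing P x, top_wing P y) \<in> \<Pi> \<and> (top_wing P y, bottom_wing P x) \<in> \<Pi> \<and>
          (bottom_wing P x, bottom_wing P y) \<in> \<Pi>))"
    (is "_ \<longleftrightarrow> ?prec \<and> ?nonc")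
proof -
  have \<Pi>: "trans \<Pi>" "irrefl \<Pi>" using assms by (auto simp: face_order_iff)
  have prec: "precedence P k \<Pi> \<longleftrightarrow> ?prec"
  proof -
    have "(\<forall>f\<in>wings x. \<forall>g\<in>wings x. light_up f \<and> \<not> light_up g \<longrightarrow>
        (label P x = M \<longrightarrow> (f, g) \<in> \<Pi>) \<and> (label P x = V \<longrightarrow> (g, f) \<in> \<Pi>)) \<longleftrightarrow>
        (top_wing P x, bottom_wing P x) \<in> \<Pi>" if "x \<in> creases k" for x
      using wings_light_dark[OF that]
      by (cases "label P x") (auto simp: top_wing_def bottom_wing_def)
    then show ?thesis by (simp add: precedence_def)
  qed
  have "noncrossing k \<Pi> \<longleftrightarrow> ?nonc" if p: ?prec
  proof -
    have asym: "(b, a) \<notin> \<Pi>" if "(a, b) \<in> \<Pi>" for a b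
      using \<Pi> that by (meson irreflD transD)
    have ends: "a = top_wing P x \<and> b = bottom_wing P x"
      if "x \<in> creases k" "wings x = {a, b}" "(a, b) \<in> \<Pi>" for x a b
    proof -
      have "{a, b} = {top_wing P x, bottom_wing P x}"
        using wings_top_bottom(1)[OF that(1), of P] that(2) by simp
      moreover have "(bottom_wing P x, top_wing P x) \<notin> \<Pi>"
        using p that(1) asym by blast
      ultimately show ?thesis
        using that(3) by (auto simp: doubleton_eq_iff)
    qed
    show ?thesis
    proof
      assume nc: "noncrossing k \<Pi>"
      show ?nonc
      proof (intro ballI impI)
        fix x y
        assume xy: "x \<in> creases k" "y \<in> creases k"
          "x \<noteq> y \<and> target_class x = target_class y \<and> wings x \<inter> wings y = {}"
        from nc[unfolded noncrossing_def, rule_format, OF this]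
          wings_top_bottom(1)[OF xy(1), of P] wings_top_bottom(1)[OF xy(2), of P] p xy(1,2)
        show "\<not> ((top_wing P x, top_wing P y) \<in> \<Pi> \<and> (top_wing P y, bottom_wing P x) \<in> \<Pi> \<and>
          (bottom_wing P x, bottom_wing P y) \<in> \<Pi>)"
          by blast
      qed
    next
      assume nonc: ?nonc
      show "noncrossing k \<Pi>"
        unfolding noncrossing_def
      proof (intro ballI impI allI)
        fix x y a0 a1 b0 b1
        assume xy: "x \<in> creases k" "y \<in> creases k"
          and d: "x \<noteq> y \<and> target_class x = target_class y \<and> wings x \<inter> wings y = {}"
          and "wings x = {a0, a1} \<and> (a0, a1) \<in> \<Pi> \<and> wings y = {b0, b1} \<and> (b0, b1) \<in> \<Pi>"
        then have e: "a0 = top_wing P x" "a1 = bottom_wing P x" "b0 = top_wing P y" "b1 = bottom_wing P y"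
          using ends by auto
        have d': "y \<noteq> x \<and> target_class y = target_class x \<and> wings y \<inter> wings x = {}"
          using d by auto
        show "\<not> ((a0, b0) \<in> \<Pi> \<and> (b0, a1) \<in> \<Pi> \<and> (a1, b1) \<in> \<Pi>) \<and>
          \<not> ((b0, a0) \<in> \<Pi> \<and> (a0, b1) \<in> \<Pi> \<and> (b1, a1) \<in> \<Pi>)"
          unfolding e using nonc[rule_format, OF xy d] nonc[rule_format, OF xy(2,1) d'] by blast
      qed
    qed
  qed
  then show ?thesis
    using assms prec by (auto simp: order_valid_def)
qed

definition key_order :: "nat \<Rightarrow> (face \<Rightarrow> int) \<Rightarrow> face rel" where
  "key_order k \<kappa> = {(x, y). x \<in> faces k \<and> y \<in> faces k \<and> \<kappa> x < \<kappa> y}"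

lemma face_order_key_order:
  assumes "inj_on \<kappa> (faces k)"
  shows "face_order k (key_order k \<kappa>)"
  using assms unfolding face_order_iff key_order_def
  by (auto simp: trans_def irrefl_def inj_on_def) (meson linorder_neqE)

section \<open>Symmetries\<close>

lemma mem_faces [simp]: "A c \<in> faces k \<longleftrightarrow> c \<in> {1..2 * k}" "B c \<in> faces k \<longleftrightarrow> c \<in> {1..2 * k}"
  by (auto simp: faces_def)

lemma mem_creases [simp]: "H c \<in> creases k \<longleftrightarrow> c \<in> {1..2 * k}"
    "U c \<in> creases k \<longleftrightarrow> c \<in> {1..2 * k - 1}" "L c \<in> creases k \<longleftrightarrow> c \<in> {1..2 * k - 1}"
  by (auto simp: creases_def)

lemma card_filter_corner:
  "card {x \<in> {H c, H (c + 1), U c, L c}. Q x} =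
    of_bool (Q (H c)) + of_bool (Q (H (c + 1))) + of_bool (Q (U c)) + of_bool (Q (L c))"
proof -
  have "card {x \<in> {H c, H (c + 1), U c, L c}. Q x} = (\<Sum>x\<in>{H c, H (c + 1), U c, L c}. of_bool (Q x))"
    by (simp add: sum_of_bool_eq Int_def)
  then show ?thesis by simp
qed

text \<open>Neighbouring columns have opposite parity, so each vertex meets both hinge labels and
  one pair \<open>u\<^sub>i\<close>, \<open>l\<^sub>i\<close>. The product of its four signs is the
  corresponding \<delta>, here -1, which means an odd number of \<open>M\<close>.\<close>

lemma locally_flat_foldable_word:
  "locally_flat_foldable (h0, h1, u0, u1, l0, l1) k" if "(h0, h1, u0, u1, l0, l1) \<in>
    {(M, M, M, M, V, V), (M, M, V, V, M, M), (V, V, M, M, V, V), (V, V, V, V, M, M),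
     (M, V, M, M, M, M), (V, M, M, M, M, M), (V, M, V, V, V, V), (M, V, V, V, V, V)}"
  unfolding locally_flat_foldable_def
proof
  fix c assume "c \<in> {1..2 * k - 1}"
  then obtain b where "c = Suc b" by (cases c) auto
  then have "(c - 1) mod 2 = 0 \<and> (c + 1 - 1) mod 2 \<noteq> 0 \<or> (c - 1) mod 2 \<noteq> 0 \<and> (c + 1 - 1) mod 2 = 0"
    by (simp add: mod_Suc)
  then show "odd (card {x \<in> {H c, H (c + 1), U c, L c}. label (h0, h1, u0, u1, l0, l1) x = M})"
    using that unfolding card_filter_corner by (elim disjE) auto
qed

lemma order_valid_imp_face_order: "order_valid P k \<Pi> \<Longrightarrow> face_order k \<Pi>"
  by (simp add: order_valid_def)

lemma F_eq: "locally_flat_foldable P k \<Longrightarrow> F P k = {\<Pi>. order_valid P k \<Pi>}"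
  by (simp add: F_def)

lemma T_C_T_C [simp]: "T_C (T_C \<Pi>) = \<Pi>"
  by (simp add: T_C_def)

lemma face_order_T_C: "face_order k \<Pi> \<Longrightarrow> face_order k (T_C \<Pi>)"
  unfolding face_order_iff T_C_def by (auto simp: irrefl_def)

text \<open>Changing every label exchanges top and bottom wings, and so does reversal. A crossing of
  x with y becomes a crossing of y with x.\<close>

lemma order_valid_T_C:
  assumes v: "order_valid P k \<Pi>" and l: "\<And>x. x \<in> creases k \<Longrightarrow> label Q x \<noteq> label P x"
  shows "order_valid Q k (T_C \<Pi>)"
proof -
  have t: "top_wing Q x = bottom_wing P x" "bottom_wing Q x = top_wing P x" if "x \<in> creases k" for x
    using l[OF that] by (cases "label P x"; cases "label Q x"; simp add: top_wing_def bottom_wing_def)+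
  note v' = v[unfolded order_valid_iff[OF order_valid_imp_face_order[OF v]]]
  have "\<not> ((top_wing P y, top_wing P x) \<in> \<Pi> \<and> (top_wing P x, bottom_wing P y) \<in> \<Pi> \<and>
          (bottom_wing P y, bottom_wing P x) \<in> \<Pi>)"
    if "x \<in> creases k" "y \<in> creases k"
      "x \<noteq> y \<and> target_class x = target_class y \<and> wings x \<inter> wings y = {}" for x y
    using v'[THEN conjunct2, rule_format, OF that(2,1)] that(3) by auto
  then show ?thesis
    unfolding order_valid_iff[OF face_order_T_C[OF order_valid_imp_face_order[OF v]]]
    using v' by (auto simp: t T_C_def)
qed

text \<open>Row exchange and column reflection both exchange light and dark faces, hence they invert
  labels. The laws are confined to \<open>faces k\<close> and \<open>creases k\<close> because the
  subtraction in \<open>phi_H\<close> and \<open>reflect_columns\<close> is truncated.\<close>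

locale colour_reversing_symmetry =
  fixes k :: nat and \<phi> :: "face \<Rightarrow> face" and \<psi> :: "crease \<Rightarrow> crease"
  assumes face_closed: "f \<in> faces k \<Longrightarrow> \<phi> f \<in> faces k"
    and face_involution: "f \<in> faces k \<Longrightarrow> \<phi> (\<phi> f) = f"
    and light_up_flip: "f \<in> faces k \<Longrightarrow> light_up (\<phi> f) \<longleftrightarrow> \<not> light_up f"
    and crease_closed: "x \<in> creases k \<Longrightarrow> \<psi> x \<in> creases k"
    and crease_involution: "x \<in> creases k \<Longrightarrow> \<psi> (\<psi> x) = x"
    and wings_image: "x \<in> creases k \<Longrightarrow> wings (\<psi> x) = \<phi> ` wings x"
    and target_class_eq: "x \<in> creases k \<Longrightarrow> target_class (\<psi> x) = target_class x"
begin

lemma inj_on_phi: "inj_on \<phi> (faces k)"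
  by (metis face_involution inj_onI)

lemma relabel_mem:
  assumes "\<Pi> \<subseteq> faces k \<times> faces k" and "a \<in> faces k" and "b \<in> faces k"
  shows "(\<phi> a, \<phi> b) \<in> relabel \<phi> \<Pi> \<longleftrightarrow> (a, b) \<in> \<Pi>"
proof
  assume "(\<phi> a, \<phi> b) \<in> relabel \<phi> \<Pi>"
  then obtain c d where cd: "(c, d) \<in> \<Pi>" "\<phi> a = \<phi> c" "\<phi> b = \<phi> d" by (auto simp: relabel_def)
  then have "a = c" "b = d"
    using assms face_involution[of a] face_involution[of b] face_involution[of c] face_involution[of d]
    by auto
  then show "(a, b) \<in> \<Pi>" using cd by simp
next
  assume "(a, b) \<in> \<Pi>"
  then have "map_prod \<phi> \<phi> (a, b) \<in> relabel \<phi> \<Pi>" unfolding relabel_def by (rule imageI)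
  then show "(\<phi> a, \<phi> b) \<in> relabel \<phi> \<Pi>" by simp
qed

lemma relabel_iff:
  assumes "\<Pi> \<subseteq> faces k \<times> faces k" and "a \<in> faces k" and "b \<in> faces k"
  shows "(a, b) \<in> relabel \<phi> \<Pi> \<longleftrightarrow> (\<phi> a, \<phi> b) \<in> \<Pi>"
  using relabel_mem[OF assms(1), of "\<phi> a" "\<phi> b"] assms by (simp add: face_closed face_involution)

lemma relabel_subset:
  assumes "\<Pi> \<subseteq> faces k \<times> faces k"
  shows "relabel \<phi> \<Pi> \<subseteq> faces k \<times> faces k"
  using assms face_closed by (auto simp: relabel_def)

lemma relabel_relabel:
  assumes "\<Pi> \<subseteq> faces k \<times> faces k"
  shows "relabel \<phi> (relabel \<phi> \<Pi>) = \<Pi>"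
proof -
  have "map_prod \<phi> \<phi> (map_prod \<phi> \<phi> z) = z" if "z \<in> \<Pi>" for z
    using that assms by (cases z) (auto simp: face_involution)
  then show ?thesis
    unfolding relabel_def image_image by simp
qed

lemma face_order_relabel:
  assumes "face_order k \<Pi>"
  shows "face_order k (relabel \<phi> \<Pi>)"
proof -
  have s: "\<Pi> \<subseteq> faces k \<times> faces k" and t: "trans \<Pi>" and i: "irrefl \<Pi>"
    and tot: "\<And>x y. x \<in> faces k \<Longrightarrow> y \<in> faces k \<Longrightarrow> x \<noteq> y \<Longrightarrow> (x, y) \<in> \<Pi> \<or> (y, x) \<in> \<Pi>"
    using assms by (auto simp: face_order_iff)
  note sub = relabel_subset[OF s]
  have inj: "\<phi> x \<noteq> \<phi> y" if "x \<in> faces k" "y \<in> faces k" "x \<noteq> y" for x y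
    using that face_involution by metis
  have "trans (relabel \<phi> \<Pi>)"
  proof (rule transI)
    fix x y z assume xyz: "(x, y) \<in> relabel \<phi> \<Pi>" "(y, z) \<in> relabel \<phi> \<Pi>"
    then have f: "x \<in> faces k" "y \<in> faces k" "z \<in> faces k" using sub by auto
    show "(x, z) \<in> relabel \<phi> \<Pi>"
      using xyz f transD[OF t] unfolding relabel_iff[OF s f(1,2)] relabel_iff[OF s f(2,3)] relabel_iff[OF s f(1,3)]
      by blast
  qed
  moreover have "irrefl (relabel \<phi> \<Pi>)"
  proof (rule irreflI)
    fix x show "(x, x) \<notin> relabel \<phi> \<Pi>"
    proof
      assume x: "(x, x) \<in> relabel \<phi> \<Pi>"
      then have f: "x \<in> faces k" using sub by auto
      show False using x i unfolding relabel_iff[OF s f f] by (simp add: irrefl_def)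
    qed
  qed
  moreover have "(x, y) \<in> relabel \<phi> \<Pi> \<or> (y, x) \<in> relabel \<phi> \<Pi>"
    if f: "x \<in> faces k" "y \<in> faces k" "x \<noteq> y" for x y
    unfolding relabel_iff[OF s f(1,2)] relabel_iff[OF s f(2,1)]
    using tot[of "\<phi> x" "\<phi> y"] inj[OF f] f face_closed by blast
  ultimately show ?thesis
    unfolding face_order_iff using sub by blast
qed

lemma light_wing_image:
  assumes "x \<in> creases k"
  shows "light_wing (\<psi> x) = \<phi> (dark_wing x)" and "dark_wing (\<psi> x) = \<phi> (light_wing x)"
proof -
  note w = wings_light_dark[OF assms] and w' = wings_light_dark[OF crease_closed[OF assms]]
  have "{light_wing (\<psi> x), dark_wing (\<psi> x)} = {\<phi> (light_wing x), \<phi> (dark_wing x)}"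
    using wings_image[OF assms] w(1) w'(1) by simp
  moreover have "\<not> light_up (\<phi> (light_wing x))" "light_up (\<phi> (dark_wing x))"
    using w light_up_flip by auto
  ultimately show "light_wing (\<psi> x) = \<phi> (dark_wing x)" "dark_wing (\<psi> x) = \<phi> (light_wing x)"
    using w'(2,3) by (auto simp: doubleton_eq_iff)
qed

text \<open>Two inversions cancel: \<phi> exchanges light and dark wings, and the labels change as
  well, so top wings go to top wings.\<close>

lemma order_valid_relabel:
  assumes v: "order_valid P k \<Pi>" and l: "\<And>x. x \<in> creases k \<Longrightarrow> label Q (\<psi> x) \<noteq> label P x"
  shows "order_valid Q k (relabel \<phi> \<Pi>)"
proof -
  note fo = order_valid_imp_face_order[OF v]
  have s: "\<Pi> \<subseteq> faces k \<times> faces k" using fo by (simp add: face_order_def)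
  have t: "top_wing Q x = \<phi> (top_wing P (\<psi> x))" "bottom_wing Q x = \<phi> (bottom_wing P (\<psi> x))"
    if "x \<in> creases k" for x
    using l[OF crease_closed[OF that]] light_wing_image[OF crease_closed[OF that]] crease_involution[OF that]
    by (cases "label P (\<psi> x)"; cases "label Q x"; simp add: top_wing_def bottom_wing_def)+
  note v' = v[unfolded order_valid_iff[OF fo]]
  have "wings (\<psi> x) \<inter> wings (\<psi> y) = {}"
    if xy: "x \<in> creases k" "y \<in> creases k" and d: "wings x \<inter> wings y = {}" for x y
  proof -
    have "wings x \<subseteq> faces k" "wings y \<subseteq> faces k"
      using wings_light_dark[OF xy(1)] wings_light_dark[OF xy(2)] by auto
    then show ?thesis
      unfolding wings_image[OF xy(1)] wings_image[OF xy(2)]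
      using d inj_on_image_Int[OF inj_on_phi, of "wings x" "wings y"] by simp
  qed
  moreover have "\<psi> x \<noteq> \<psi> y" if "x \<in> creases k" "y \<in> creases k" "x \<noteq> y" for x y
    using that crease_involution by metis
  ultimately have d: "\<psi> x \<noteq> \<psi> y \<and> target_class (\<psi> x) = target_class (\<psi> y) \<and> wings (\<psi> x) \<inter> wings (\<psi> y) = {}"
    if "x \<in> creases k" "y \<in> creases k"
      "x \<noteq> y \<and> target_class x = target_class y \<and> wings x \<inter> wings y = {}" for x y
    using that target_class_eq by simp
  have f: "top_wing P (\<psi> x) \<in> faces k" "bottom_wing P (\<psi> x) \<in> faces k" if "x \<in> creases k" for x
    using wings_top_bottom[OF crease_closed[OF that]] by auto
  show ?thesis
    unfolding order_valid_iff[OF face_order_relabel[OF fo]]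
  proof (intro conjI ballI impI)
    fix x assume x: "x \<in> creases k"
    show "(top_wing Q x, bottom_wing Q x) \<in> relabel \<phi> \<Pi>"
      using v' x by (simp add: t relabel_mem[OF s] f crease_closed)
  next
    fix x y assume xy: "x \<in> creases k" "y \<in> creases k"
      "x \<noteq> y \<and> target_class x = target_class y \<and> wings x \<inter> wings y = {}"
    show "\<not> ((top_wing Q x, top_wing Q y) \<in> relabel \<phi> \<Pi> \<and> (top_wing Q y, bottom_wing Q x) \<in> relabel \<phi> \<Pi> \<and>
      (bottom_wing Q x, bottom_wing Q y) \<in> relabel \<phi> \<Pi>)"
      using v'[THEN conjunct2, rule_format, OF crease_closed[OF xy(1)] crease_closed[OF xy(2)] d[OF xy]] xy
      by (simp add: t relabel_mem[OF s] f)
  qed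
qed

end

fun exchange_rows :: "crease \<Rightarrow> crease" where
  "exchange_rows (H c) = H c"
| "exchange_rows (U i) = L i"
| "exchange_rows (L i) = U i"

fun reflect_columns :: "nat \<Rightarrow> crease \<Rightarrow> crease" where
  "reflect_columns k (H c) = H (2 * k + 1 - c)"
| "reflect_columns k (U i) = U (2 * k - i)"
| "reflect_columns k (L i) = L (2 * k - i)"

interpretation rows: colour_reversing_symmetry k phi_R exchange_rows for k
proof
  fix f assume "f \<in> faces k"
  then show "phi_R f \<in> faces k" "phi_R (phi_R f) = f" "light_up (phi_R f) \<longleftrightarrow> \<not> light_up f"
    by (cases f; simp)+
next
  fix x assume "x \<in> creases k"
  then show "exchange_rows x \<in> creases k" "exchange_rows (exchange_rows x) = x"
    "wings (exchange_rows x) = phi_R ` wings x" "target_class (exchange_rows x) = target_class x"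
    by (cases x; auto)+
qed

interpretation columns: colour_reversing_symmetry k "phi_H k" "reflect_columns k" for k
proof
  fix f assume "f \<in> faces k"
  then show "phi_H k f \<in> faces k" "phi_H k (phi_H k f) = f"
    "light_up (phi_H k f) \<longleftrightarrow> \<not> light_up f"
    by (cases f; auto)+
next
  fix x assume "x \<in> creases k"
  then show "reflect_columns k x \<in> creases k" "reflect_columns k (reflect_columns k x) = x"
    "wings (reflect_columns k x) = phi_H k ` wings x"
    "target_class (reflect_columns k x) = target_class x"
    by (cases x; auto simp: Suc_diff_le)+
qed

section \<open>Existence\<close>

definition key_crosses :: "(face \<Rightarrow> int) \<Rightarrow> word \<Rightarrow> crease \<Rightarrow> crease \<Rightarrow> bool" where
  "key_crosses \<kappa> P x y \<longleftrightarrow> \<kappa> (top_wing P x) < \<kappa> (top_wing P y) \<and>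
     \<kappa> (top_wing P y) < \<kappa> (bottom_wing P x) \<and> \<kappa> (bottom_wing P x) < \<kappa> (bottom_wing P y)"

lemma order_valid_key_order:
  assumes "inj_on \<kappa> (faces k)"
    and "\<And>x. x \<in> creases k \<Longrightarrow> \<kappa> (top_wing P x) < \<kappa> (bottom_wing P x)"
    and "\<And>x y. x \<in> creases k \<Longrightarrow> y \<in> creases k \<Longrightarrow> x \<noteq> y \<Longrightarrow> target_class x = target_class y \<Longrightarrow>
      \<not> key_crosses \<kappa> P x y"
  shows "order_valid P k (key_order k \<kappa>)"
  unfolding order_valid_iff[OF face_order_key_order[OF assms(1)]]
  using assms(2,3) wings_top_bottom[where k = k and P = P]
  by (auto simp: key_order_def key_crosses_def)

text \<open>Keys of the states to be constructed. For \<open>MMMMVV\<close>: \<open>nested_key\<close> puts the two faces of a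
  column next to each other (\<open>\<alpha> = \<beta>\<close>), and \<open>outer_key\<close> (\<open>\<alpha> = 1\<close>) starts from the lower faces in the
  order \<open>W\<^sub>p\<close> and inserts each odd \<open>A c\<close> just before the first \<open>B d\<close> with odd \<open>d \<ge> c\<close> and each even
  \<open>A c\<close> just after the last \<open>B d\<close> with even \<open>d \<ge> c\<close>.
  For \<open>MVMMMM\<close>: \<open>mirror_key\<close> puts \<open>W\<^sub>p\<close> above its mirror image, while \<open>up_key\<close> (pivots \<open>p, p + 1\<close>, \<open>p\<close> even)
  and \<open>down_key\<close> (pivots \<open>p, p - 1\<close>, \<open>p\<close> odd) use that the two words are \<open>O X Y\<close> and \<open>O Y X\<close>
  for a common first column \<open>O\<close> and common blocks \<open>X\<close>, \<open>Y\<close>: the faces of one block are stacked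
  entirely before those of the other, inside the two faces of column \<open>O\<close>. The multiples of
  \<open>100k\<close> only separate these stacks.\<close>

fun nested_key :: "nat \<Rightarrow> nat \<Rightarrow> face \<Rightarrow> int" where
  "nested_key k p (A c) = 2 * rank k p c + (if odd c then 0 else 1)"
| "nested_key k p (B c) = 2 * rank k p c + (if odd c then 1 else 0)"

fun outer_key :: "nat \<Rightarrow> nat \<Rightarrow> face \<Rightarrow> int" where
  "outer_key k p (A c) =
     (if odd c then if c \<le> p + 1 then int c - 100 * int k else 2 * rank k p c - 1
      else if p < c then 2 * rank k p c + 1 else 100 * int k - int c)"
| "outer_key k p (B c) = 2 * rank k p c"

fun mirror_key :: "nat \<Rightarrow> nat \<Rightarrow> face \<Rightarrow> int" where
  "mirror_key k p (A c) = rank k p c"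
| "mirror_key k p (B c) = 100 * int k - rank k p c"

fun up_key :: "nat \<Rightarrow> nat \<Rightarrow> face \<Rightarrow> int" where
  "up_key k p (A c) = rank k p c + (if c \<le> p then 200 * int k else 0)"
| "up_key k p (B c) = (if c = p + 1 then 500 * int k
     else if p < c then 100 * int k - rank k p c else 400 * int k - rank k p c)"

fun down_key :: "nat \<Rightarrow> nat \<Rightarrow> face \<Rightarrow> int" where
  "down_key k p (A c) = rank k p c + (if p < c then 200 * int k else 0)"
| "down_key k p (B c) = (if c = p then 500 * int k
     else if c < p then 100 * int k - rank k p c else 400 * int k - rank k p c)"

lemma inj_on_faces_keyI:
  assumes "inj_on (\<lambda>c. \<kappa> (A c)) {1..2 * k}" and "inj_on (\<lambda>c. \<kappa> (B c)) {1..2 * k}"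
    and "\<And>c d. c \<in> {1..2 * k} \<Longrightarrow> d \<in> {1..2 * k} \<Longrightarrow> \<kappa> (A c) \<noteq> \<kappa> (B d)"
  shows "inj_on \<kappa> (faces k)"
proof (rule inj_onI)
  fix f g assume "f \<in> faces k" "g \<in> faces k" "\<kappa> f = \<kappa> g"
  then show "f = g"
    using assms(3) inj_onD[OF assms(1)] inj_onD[OF assms(2)] by (cases f; cases g) (auto, metis)
qed

text \<open>The one parity fact that linear arithmetic misses when the rank of an odd column is
  compared with a rank of the form \<open>4 * int k - int d\<close>.\<close>

lemma odd_less_double: "odd (c::nat) \<Longrightarrow> c \<le> 2 * k \<Longrightarrow> c < 2 * k"
  by (metis dvd_triv_left le_neq_implies_less)

lemma rank_inj:
  assumes "p \<in> {1..2 * k - 1}" "c \<in> {1..2 * k}" "d \<in> {1..2 * k}" "rank k p c = rank k p d"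
  shows "c = d"
  using assms odd_less_double[of c k] odd_less_double[of d k]
  by (cases "odd c"; cases "odd d") (auto simp: rank_def split: if_splits)

text \<open>In every word an odd column precedes its even neighbours. This is what \<tau> = 1 asks
  for, since equal labels on all creases of a row send all of them from odd to even columns, or all
  from even to odd.\<close>

lemma rank_adjacent:
  assumes "p \<in> {1..2 * k - 1}" and "c \<in> {1..2 * k - 1}"
  shows "if odd c then rank k p c < rank k p (c + 1) else rank k p (c + 1) < rank k p c"
  using assms odd_less_double[of c k] odd_less_double[of "c + 1" k]
  by (cases c p rule: linorder_cases) (auto simp: rank_def)

text \<open>Each block of \<open>W\<^sub>p\<close> lists odd and even columns in opposite
  directions, so pairs of neighbours of one target class inside a block are nested concentrically.
  Pairs in different blocks are separated, and the pair p, p + 1 occupies the two ends of the word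
  and encloses everything.\<close>

lemma rank_noncrossing:
  assumes "p \<in> {1..2 * k - 1}" and "c \<in> {1..2 * k - 1}" and "d \<in> {1..2 * k - 1}" and "c \<noteq> d"
  shows "odd c \<Longrightarrow> odd d \<Longrightarrow>
      \<not> (rank k p c < rank k p d \<and> rank k p d < rank k p (c + 1) \<and> rank k p (c + 1) < rank k p (d + 1))"
    and "even c \<Longrightarrow> even d \<Longrightarrow>
      \<not> (rank k p (c + 1) < rank k p (d + 1) \<and> rank k p (d + 1) < rank k p c \<and> rank k p c < rank k p d)"
proof -
  note less = odd_less_double[of c k] odd_less_double[of d k]
     odd_less_double[of "c + 1" k] odd_less_double[of "d + 1" k]
  show "\<not> (rank k p c < rank k p d \<and> rank k p d < rank k p (c + 1) \<and> rank k p (c + 1) < rank k p (d + 1))"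
    if "odd c" "odd d"
    using assms less that
    by (cases c p rule: linorder_cases; cases d p rule: linorder_cases) (auto simp: rank_def split: if_splits)
  show "\<not> (rank k p (c + 1) < rank k p (d + 1) \<and> rank k p (d + 1) < rank k p c \<and> rank k p c < rank k p d)"
    if "even c" "even d"
    using assms less that
    by (cases c p rule: linorder_cases; cases d p rule: linorder_cases) (auto simp: rank_def split: if_splits)
qed

section \<open>Criteria for key orders and the compatible states of the two base words\<close>

abbreviation (input) "MMMMVV \<equiv> (M, M, M, M, V, V)"
abbreviation (input) "MVMMMM \<equiv> (M, V, M, M, M, M)"

lemma wings_MMMMVV:
  "top_wing MMMMVV (H c) = (if odd c then A c else B c)"
  "bottom_wing MMMMVV (H c) = (if odd c then B c else A c)"
  "top_wing MMMMVV (U c) = (if odd c then A c else A (c + 1))"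
  "bottom_wing MMMMVV (U c) = (if odd c then A (c + 1) else A c)"
  "top_wing MMMMVV (L c) = (if odd c then B c else B (c + 1))"
  "bottom_wing MMMMVV (L c) = (if odd c then B (c + 1) else B c)"
  by (simp_all add: top_wing_def bottom_wing_def)

lemma wings_MVMMMM:
  assumes "c \<ge> 1"
  shows "top_wing MVMMMM (H c) = A c"
  "bottom_wing MVMMMM (H c) = B c"
  "top_wing MVMMMM (U c) = (if odd c then A c else A (c + 1))"
  "bottom_wing MVMMMM (U c) = (if odd c then A (c + 1) else A c)"
  "top_wing MVMMMM (L c) = (if odd c then B (c + 1) else B c)"
  "bottom_wing MVMMMM (L c) = (if odd c then B c else B (c + 1))"
  using assms by (auto simp: top_wing_def bottom_wing_def mod_2_eq_odd)

text \<open>Precedence and noncrossing inside a row depend only on its word and hold for every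
  pivot. What is left to check for a concrete key is the hinges and the creases of one row against
  those of the other.\<close>

lemma key_order_MMMMVV:
  assumes \<alpha>: "\<alpha> \<in> {1..2 * k - 1}" and \<beta>: "\<beta> \<in> {1..2 * k - 1}"
    and A: "\<And>c d. c \<in> {1..2 * k} \<Longrightarrow> d \<in> {1..2 * k} \<Longrightarrow> \<kappa> (A c) < \<kappa> (A d) \<longleftrightarrow> rank k \<alpha> c < rank k \<alpha> d"
    and B: "\<And>c d. c \<in> {1..2 * k} \<Longrightarrow> d \<in> {1..2 * k} \<Longrightarrow> \<kappa> (B c) < \<kappa> (B d) \<longleftrightarrow> rank k \<beta> c < rank k \<beta> d"
    and AB: "\<And>c d. c \<in> {1..2 * k} \<Longrightarrow> d \<in> {1..2 * k} \<Longrightarrow> \<kappa> (A c) \<noteq> \<kappa> (B d)"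
    and hinge: "\<And>c. c \<in> {1..2 * k} \<Longrightarrow> if odd c then \<kappa> (A c) < \<kappa> (B c) else \<kappa> (B c) < \<kappa> (A c)"
    and HH: "\<And>c d. c \<in> {1..2 * k} \<Longrightarrow> d \<in> {1..2 * k} \<Longrightarrow> c \<noteq> d \<Longrightarrow>
      \<not> key_crosses \<kappa> MMMMVV (H c) (H d)"
    and UL: "\<And>c d. c \<in> {1..2 * k - 1} \<Longrightarrow> d \<in> {1..2 * k - 1} \<Longrightarrow> odd c \<longleftrightarrow> odd d \<Longrightarrow>
      \<not> key_crosses \<kappa> MMMMVV (U c) (L d) \<and> \<not> key_crosses \<kappa> MMMMVV (L c) (U d)"
  shows "\<exists>\<Pi>\<in>F MMMMVV k. has_pivot_pair k \<Pi> \<alpha> \<beta>"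
proof
  have c1: "c \<in> {1..2 * k}" "c + 1 \<in> {1..2 * k}" if "c \<in> {1..2 * k - 1}" for c using that by auto
  have "inj_on \<kappa> (faces k)"
  proof (rule inj_on_faces_keyI; (rule inj_onI)?)
    show "c = d" if cd: "c \<in> {1..2 * k}" "d \<in> {1..2 * k}" and "\<kappa> (A c) = \<kappa> (A d)" for c d
      using A[OF cd] A[OF cd(2,1)] that(3) by (intro rank_inj[OF \<alpha> cd]) simp
    show "c = d" if cd: "c \<in> {1..2 * k}" "d \<in> {1..2 * k}" and "\<kappa> (B c) = \<kappa> (B d)" for c d
      using B[OF cd] B[OF cd(2,1)] that(3) by (intro rank_inj[OF \<beta> cd]) simp
  qed (rule AB)
  then have "order_valid MMMMVV k (key_order k \<kappa>)"
  proof (rule order_valid_key_order)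
    fix x assume x: "x \<in> creases k"
    show "\<kappa> (top_wing MMMMVV x) < \<kappa> (bottom_wing MMMMVV x)"
    proof (cases x)
      case (H c) then show ?thesis using x hinge[of c] by (simp add: wings_MMMMVV split: if_splits)
    next
      case (U c) then show ?thesis using x rank_adjacent[OF \<alpha>, of c] A c1[of c]
        by (simp add: wings_MMMMVV split: if_splits)
    next
      case (L c) then show ?thesis using x rank_adjacent[OF \<beta>, of c] B c1[of c]
        by (simp add: wings_MMMMVV split: if_splits)
    qed
  next
    fix x y assume xy: "x \<in> creases k" "y \<in> creases k" "x \<noteq> y" "target_class x = target_class y"
    have UU: "\<not> key_crosses \<kappa> MMMMVV (U c) (U d)"
      if "c \<in> {1..2 * k - 1}" "d \<in> {1..2 * k - 1}" "odd c \<longleftrightarrow> odd d" "c \<noteq> d" for c d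
      using rank_noncrossing[OF \<alpha> that(1,2,4)] A c1[OF that(1)] c1[OF that(2)] that(3)
      by (simp add: key_crosses_def wings_MMMMVV split: if_splits)
    have LL: "\<not> key_crosses \<kappa> MMMMVV (L c) (L d)"
      if "c \<in> {1..2 * k - 1}" "d \<in> {1..2 * k - 1}" "odd c \<longleftrightarrow> odd d" "c \<noteq> d" for c d
      using rank_noncrossing[OF \<beta> that(1,2,4)] B c1[OF that(1)] c1[OF that(2)] that(3)
      by (simp add: key_crosses_def wings_MMMMVV split: if_splits)
    show "\<not> key_crosses \<kappa> MMMMVV x y"
      using xy HH UL UU LL by (cases x; cases y) (auto split: if_splits)
  qed
  then show "key_order k \<kappa> \<in> F MMMMVV k"
    by (simp add: F_eq locally_flat_foldable_word)
  show "has_pivot_pair k (key_order k \<kappa>) \<alpha> \<beta>"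
    unfolding has_pivot_pair_iff[OF \<alpha> \<beta>] row_sorted_def key_order_def using A B by auto
qed

lemma key_order_MVMMMM:
  assumes \<alpha>: "\<alpha> \<in> {1..2 * k - 1}" and \<beta>: "\<beta> \<in> {1..2 * k - 1}"
    and A: "\<And>c d. c \<in> {1..2 * k} \<Longrightarrow> d \<in> {1..2 * k} \<Longrightarrow> \<kappa> (A c) < \<kappa> (A d) \<longleftrightarrow> rank k \<alpha> c < rank k \<alpha> d"
    and B: "\<And>c d. c \<in> {1..2 * k} \<Longrightarrow> d \<in> {1..2 * k} \<Longrightarrow> \<kappa> (B c) < \<kappa> (B d) \<longleftrightarrow> rank k \<beta> d < rank k \<beta> c"
    and AB: "\<And>c d. c \<in> {1..2 * k} \<Longrightarrow> d \<in> {1..2 * k} \<Longrightarrow> \<kappa> (A c) \<noteq> \<kappa> (B d)"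
    and hinge: "\<And>c. c \<in> {1..2 * k} \<Longrightarrow> \<kappa> (A c) < \<kappa> (B c)"
    and HH: "\<And>c d. c \<in> {1..2 * k} \<Longrightarrow> d \<in> {1..2 * k} \<Longrightarrow> c \<noteq> d \<Longrightarrow>
      \<not> key_crosses \<kappa> MVMMMM (H c) (H d)"
    and UL: "\<And>c d. c \<in> {1..2 * k - 1} \<Longrightarrow> d \<in> {1..2 * k - 1} \<Longrightarrow> odd c \<longleftrightarrow> odd d \<Longrightarrow>
      \<not> key_crosses \<kappa> MVMMMM (U c) (L d) \<and> \<not> key_crosses \<kappa> MVMMMM (L c) (U d)"
  shows "\<exists>\<Pi>\<in>F MVMMMM k. has_pivot_pair k \<Pi> \<alpha> \<beta>"
proof
  have c1: "c \<in> {1..2 * k}" "c + 1 \<in> {1..2 * k}" if "c \<in> {1..2 * k - 1}" for c using that by auto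
  have "inj_on \<kappa> (faces k)"
  proof (rule inj_on_faces_keyI; (rule inj_onI)?)
    show "c = d" if cd: "c \<in> {1..2 * k}" "d \<in> {1..2 * k}" and "\<kappa> (A c) = \<kappa> (A d)" for c d
      using A[OF cd] A[OF cd(2,1)] that(3) by (intro rank_inj[OF \<alpha> cd]) simp
    show "c = d" if cd: "c \<in> {1..2 * k}" "d \<in> {1..2 * k}" and "\<kappa> (B c) = \<kappa> (B d)" for c d
      using B[OF cd] B[OF cd(2,1)] that(3) by (intro rank_inj[OF \<beta> cd]) simp
  qed (rule AB)
  then have "order_valid MVMMMM k (key_order k \<kappa>)"
  proof (rule order_valid_key_order)
    fix x assume x: "x \<in> creases k"
    show "\<kappa> (top_wing MVMMMM x) < \<kappa> (bottom_wing MVMMMM x)"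
    proof (cases x)
      case (H c) then show ?thesis using x hinge[of c] by (simp add: wings_MVMMMM split: if_splits)
    next
      case (U c) then show ?thesis using x rank_adjacent[OF \<alpha>, of c] A c1[of c]
        by (simp add: wings_MVMMMM split: if_splits)
    next
      case (L c) then show ?thesis using x rank_adjacent[OF \<beta>, of c] B c1[of c]
        by (simp add: wings_MVMMMM split: if_splits)
    qed
  next
    fix x y assume xy: "x \<in> creases k" "y \<in> creases k" "x \<noteq> y" "target_class x = target_class y"
    have UU: "\<not> key_crosses \<kappa> MVMMMM (U c) (U d)"
      if "c \<in> {1..2 * k - 1}" "d \<in> {1..2 * k - 1}" "odd c \<longleftrightarrow> odd d" "c \<noteq> d" for c d
      using rank_noncrossing[OF \<alpha> that(1,2,4)] A c1[OF that(1)] c1[OF that(2)] that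
      by (simp add: key_crosses_def wings_MVMMMM split: if_splits)
    \<comment> \<open>The lower row runs backwards, so a crossing of c with d in the order is one of
      d with c in the ranks; hence the exchanged arguments.\<close>
    have LL: "\<not> key_crosses \<kappa> MVMMMM (L c) (L d)"
      if "c \<in> {1..2 * k - 1}" "d \<in> {1..2 * k - 1}" "odd c \<longleftrightarrow> odd d" "c \<noteq> d" for c d
      using rank_noncrossing[OF \<beta> that(2,1) that(4)[symmetric]] B c1[OF that(1)] c1[OF that(2)] that
      by (auto simp: key_crosses_def wings_MVMMMM split: if_splits)
    show "\<not> key_crosses \<kappa> MVMMMM x y"
      using xy HH UL UU LL by (cases x; cases y) (auto split: if_splits)
  qed
  then show "key_order k \<kappa> \<in> F MVMMMM k"
    by (simp add: F_eq locally_flat_foldable_word)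
  show "has_pivot_pair k (key_order k \<kappa>) \<alpha> \<beta>"
    unfolding has_pivot_pair_iff[OF \<alpha> \<beta>] row_sorted_def key_order_def using A B by auto
qed

text \<open>Nothing fits between the two faces of a column, so no hinge can be crossed. The interval
  of \<open>U c\<close> encloses that of \<open>L c\<close>, and for different columns the ranks
  decide.\<close>

lemma nested_MMMMVV:
  assumes p: "p \<in> {1..2 * k - 1}"
  shows "\<exists>\<Pi>\<in>F MMMMVV k. has_pivot_pair k \<Pi> p p"
proof (rule key_order_MMMMVV[OF p p, where \<kappa> = "nested_key k p"])
  fix c d assume cd: "c \<in> {1..2 * k}" "d \<in> {1..2 * k}"
  show "nested_key k p (A c) < nested_key k p (A d) \<longleftrightarrow> rank k p c < rank k p d"
    using rank_inj[OF p cd] by (cases "rank k p c = rank k p d") auto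
  show "nested_key k p (B c) < nested_key k p (B d) \<longleftrightarrow> rank k p c < rank k p d"
    using rank_inj[OF p cd] by (cases "rank k p c = rank k p d") auto
  show "nested_key k p (A c) \<noteq> nested_key k p (B d)"
    using rank_inj[OF p cd] by (auto split: if_splits)
  show "\<not> key_crosses (nested_key k p) MMMMVV (H c) (H d)"
    by (auto simp: key_crosses_def wings_MMMMVV split: if_splits)
next
  fix c d assume cd: "c \<in> {1..2 * k - 1}" "d \<in> {1..2 * k - 1}" "odd c \<longleftrightarrow> odd d"
  have c1: "c \<in> {1..2 * k}" "d \<in> {1..2 * k}" "c + 1 \<in> {1..2 * k}" "d + 1 \<in> {1..2 * k}"
    using cd by auto
  have ne: "rank k p c \<noteq> rank k p d" "rank k p (c + 1) \<noteq> rank k p (d + 1)" if "c \<noteq> d"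
    using that rank_inj[OF p c1(1,2)] rank_inj[OF p c1(3,4)] by auto
  show "\<not> key_crosses (nested_key k p) MMMMVV (U c) (L d) \<and>
      \<not> key_crosses (nested_key k p) MMMMVV (L c) (U d)"
    using rank_noncrossing[OF p cd(1,2)] cd(3) ne
    by (cases "c = d"; cases "odd c") (auto simp: key_crosses_def wings_MMMMVV)
qed auto

text \<open>In \<open>W\<^sub>1\<close> the odd columns ascend and the even ones then descend. For
  odd c \<le> d, \<open>A c\<close> is \<open>A d\<close> or above it, and \<open>A d\<close> is
  above \<open>B d\<close>; the key gives \<open>A c\<close> the lowest place that respects this.
  Dually, an even \<open>A c\<close> gets the highest place below every \<open>B d\<close> with even
  d \<ge> c.\<close>

lemma outer_MMMMVV:
  assumes p: "p \<in> {1..2 * k - 1}"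
  shows "\<exists>\<Pi>\<in>F MMMMVV k. has_pivot_pair k \<Pi> 1 p"
proof (rule key_order_MMMMVV[OF _ p, where \<kappa> = "outer_key k p"])
  show "1 \<in> {1..2 * k - 1}" using p by auto
  fix c d assume cd: "c \<in> {1..2 * k}" "d \<in> {1..2 * k}"
  note less = odd_less_double[of c k] odd_less_double[of d k]
  show "outer_key k p (A c) < outer_key k p (A d) \<longleftrightarrow> rank k 1 c < rank k 1 d"
    using cd p less by (cases "odd c"; cases "odd d") (auto simp: rank_def)
  show "outer_key k p (B c) < outer_key k p (B d) \<longleftrightarrow> rank k p c < rank k p d"
    by simp
  \<comment> \<open>Lower keys are even and lie between -4k and 12k. An upper key is either odd and
    next to a lower one, or outside that range by the offset 100k.\<close>
  show "outer_key k p (A c) \<noteq> outer_key k p (B d)"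
    using cd p less by (cases "odd c"; cases "odd d"; (auto simp: rank_def; presburger))
  show "\<not> key_crosses (outer_key k p) MMMMVV (H c) (H d)"
    using cd p less
    by (cases "odd c"; cases "odd d"; cases "c = p + 1"; cases "d = p + 1")
      (auto simp: key_crosses_def wings_MMMMVV rank_def split: if_splits)
next
  fix c assume "c \<in> {1..2 * k}"
  then show "if odd c then outer_key k p (A c) < outer_key k p (B c)
      else outer_key k p (B c) < outer_key k p (A c)"
    using p by (auto simp: rank_def)
next
  fix c d assume cd: "c \<in> {1..2 * k - 1}" "d \<in> {1..2 * k - 1}" "odd c \<longleftrightarrow> odd d"
  note less = odd_less_double[of c k] odd_less_double[of d k]
     odd_less_double[of "c + 1" k] odd_less_double[of "d + 1" k]
  show "\<not> key_crosses (outer_key k p) MMMMVV (U c) (L d) \<and>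
      \<not> key_crosses (outer_key k p) MMMMVV (L c) (U d)"
    using cd p less
    by (cases c p rule: linorder_cases; cases d p rule: linorder_cases; cases "c = p + 1";
        cases "d = p + 1"; cases "odd c")
      (auto simp: key_crosses_def wings_MMMMVV rank_def split: if_splits)
qed

text \<open>All upper faces come first, followed by the lower ones in mirrored order: hinges are
  nested concentrically and no \<open>U\<close> interval meets an \<open>L\<close> interval. The
  bound 20k is a generous one, as ranks stay below 6k.\<close>

lemma mirror_MVMMMM:
  assumes p: "p \<in> {1..2 * k - 1}"
  shows "\<exists>\<Pi>\<in>F MVMMMM k. has_pivot_pair k \<Pi> p p"
proof (rule key_order_MVMMMM[OF p p, where \<kappa> = "mirror_key k p"])
  have less: "rank k p c < 20 * int k" if "c \<in> {1..2 * k}" for c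
    using that p by (auto simp: rank_def)
  fix c d assume cd: "c \<in> {1..2 * k}" "d \<in> {1..2 * k}"
  show "mirror_key k p (A c) \<noteq> mirror_key k p (B d)"
    using less[OF cd(1)] less[OF cd(2)] cd by auto
  show "mirror_key k p (A c) < mirror_key k p (B c)"
    using less[OF cd(1)] cd by auto
  show "\<not> key_crosses (mirror_key k p) MVMMMM (H c) (H d)"
    using cd by (auto simp: key_crosses_def wings_MVMMMM)
next
  have less: "rank k p c < 20 * int k" if "c \<in> {1..2 * k}" for c
    using that p by (auto simp: rank_def)
  fix c d assume cd: "c \<in> {1..2 * k - 1}" "d \<in> {1..2 * k - 1}" "odd c \<longleftrightarrow> odd d"
  have c1: "c \<in> {1..2 * k}" "d \<in> {1..2 * k}" "c + 1 \<in> {1..2 * k}" "d + 1 \<in> {1..2 * k}"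
    using cd by auto
  show "\<not> key_crosses (mirror_key k p) MVMMMM (U c) (L d) \<and>
      \<not> key_crosses (mirror_key k p) MVMMMM (L c) (U d)"
    using less[OF c1(1)] less[OF c1(2)] less[OF c1(3)] less[OF c1(4)] cd
    by (auto simp: key_crosses_def wings_MVMMMM)
qed auto

text \<open>Within a block the upper faces are followed by the mirrored lower ones, so hinges are
  nested, and the hinge of column p + 1 encloses both blocks. A \<open>U\<close> and an
  \<open>L\<close> interval overlap only if one of them ends at column p + 1. The creases
  \<open>U p\<close> and \<open>L (p + 1)\<close> do cross, but their target classes are
  \<open>W\<close> and \<open>E\<close>.\<close>

lemma up_MVMMMM:
  assumes p: "p \<in> {1..2 * k - 2}" and "even p"
  shows "\<exists>\<Pi>\<in>F MVMMMM k. has_pivot_pair k \<Pi> p (p + 1)"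
proof (rule key_order_MVMMMM[where \<kappa> = "up_key k p"])
  show "p \<in> {1..2 * k - 1}" "p + 1 \<in> {1..2 * k - 1}" using p by auto
  fix c d assume cd: "c \<in> {1..2 * k}" "d \<in> {1..2 * k}"
  note less = odd_less_double[of c k] odd_less_double[of d k]
  show "up_key k p (A c) < up_key k p (A d) \<longleftrightarrow> rank k p c < rank k p d"
    using cd assms less by (cases "odd c"; cases "odd d") (auto simp: rank_def)
  show "up_key k p (B c) < up_key k p (B d) \<longleftrightarrow> rank k (p + 1) d < rank k (p + 1) c"
    using cd assms less
    by (cases c "p + 1" rule: linorder_cases; cases d "p + 1" rule: linorder_cases) (auto simp: rank_def)
  show "up_key k p (A c) \<noteq> up_key k p (B d)"
    using cd assms less by (cases "odd c"; cases "odd d") (auto simp: rank_def)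
  show "\<not> key_crosses (up_key k p) MVMMMM (H c) (H d)"
    using cd assms less
    by (cases c "p + 1" rule: linorder_cases; cases d "p + 1" rule: linorder_cases)
      (auto simp: key_crosses_def wings_MVMMMM rank_def split: if_splits)
next
  fix c assume "c \<in> {1..2 * k}"
  then show "up_key k p (A c) < up_key k p (B c)"
    using assms by (auto simp: rank_def)
next
  fix c d assume cd: "c \<in> {1..2 * k - 1}" "d \<in> {1..2 * k - 1}" "odd c \<longleftrightarrow> odd d"
  note less = odd_less_double[of c k] odd_less_double[of d k]
     odd_less_double[of "c + 1" k] odd_less_double[of "d + 1" k]
  show "\<not> key_crosses (up_key k p) MVMMMM (U c) (L d) \<and>
      \<not> key_crosses (up_key k p) MVMMMM (L c) (U d)"
    using cd assms less
    by (cases c p rule: linorder_cases; cases d p rule: linorder_cases; cases "odd c")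
      (auto simp: key_crosses_def wings_MVMMMM rank_def split: if_splits)
qed

text \<open>The common first column is now p, and the lower block is stacked before the upper one.
  The crossing pair is \<open>U p\<close> and \<open>L (p - 1)\<close>, again of different target
  classes.\<close>

lemma down_MVMMMM:
  assumes p: "p \<in> {2..2 * k - 1}" and "odd p"
  shows "\<exists>\<Pi>\<in>F MVMMMM k. has_pivot_pair k \<Pi> p (p - 1)"
proof (rule key_order_MVMMMM[where \<kappa> = "down_key k p"])
  show "p \<in> {1..2 * k - 1}" "p - 1 \<in> {1..2 * k - 1}" using p by auto
  fix c d assume cd: "c \<in> {1..2 * k}" "d \<in> {1..2 * k}"
  note less = odd_less_double[of c k] odd_less_double[of d k]
  show "down_key k p (A c) < down_key k p (A d) \<longleftrightarrow> rank k p c < rank k p d"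
    using cd assms less by (cases "odd c"; cases "odd d") (auto simp: rank_def)
  show "down_key k p (B c) < down_key k p (B d) \<longleftrightarrow> rank k (p - 1) d < rank k (p - 1) c"
    using cd assms less
    by (cases c p rule: linorder_cases; cases d p rule: linorder_cases) (auto simp: rank_def)
  show "down_key k p (A c) \<noteq> down_key k p (B d)"
    using cd assms less by (cases "odd c"; cases "odd d") (auto simp: rank_def)
  show "\<not> key_crosses (down_key k p) MVMMMM (H c) (H d)"
    using cd assms less
    by (cases c p rule: linorder_cases; cases d p rule: linorder_cases)
      (auto simp: key_crosses_def wings_MVMMMM rank_def split: if_splits)
next
  fix c assume "c \<in> {1..2 * k}"
  then show "down_key k p (A c) < down_key k p (B c)"
    using assms by (auto simp: rank_def)
next
  fix c d assume cd: "c \<in> {1..2 * k - 1}" "d \<in> {1..2 * k - 1}" "odd c \<longleftrightarrow> odd d"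
  note less = odd_less_double[of c k] odd_less_double[of d k]
     odd_less_double[of "c + 1" k] odd_less_double[of "d + 1" k]
  show "\<not> key_crosses (down_key k p) MVMMMM (U c) (L d) \<and>
      \<not> key_crosses (down_key k p) MVMMMM (L c) (U d)"
    using cd assms less
    by (cases c p rule: linorder_cases; cases d p rule: linorder_cases; cases "odd c")
      (auto simp: key_crosses_def wings_MVMMMM rank_def split: if_splits)
qed

section \<open>State sets under the symmetries\<close>

lemma F_subset: "\<Pi> \<in> F P k \<Longrightarrow> \<Pi> \<subseteq> faces k \<times> faces k"
  by (auto simp: F_def order_valid_def face_order_def split: if_splits)

lemma F_T_C:
  assumes "locally_flat_foldable P k" and "locally_flat_foldable Q k"
    and "\<And>x. x \<in> creases k \<Longrightarrow> label Q x \<noteq> label P x"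
  shows "F Q k = T_C ` F P k"
proof -
  have "\<Pi> \<in> T_C ` F P k" if "\<Pi> \<in> F Q k" for \<Pi>
    using order_valid_T_C[of Q k \<Pi> P, OF _ assms(3)[symmetric]] that assms by (intro image_eqI[of _ _ "T_C \<Pi>"]) (auto simp: F_eq)
  then show ?thesis
    using order_valid_T_C[of P k _ Q] assms by (auto simp: F_eq)
qed

lemma (in colour_reversing_symmetry) F_relabel:
  assumes "locally_flat_foldable P k" and "locally_flat_foldable Q k"
    and l: "\<And>x. x \<in> creases k \<Longrightarrow> label Q (\<psi> x) \<noteq> label P x"
  shows "F Q k = relabel \<phi> ` F P k"
proof -
  have l': "label P (\<psi> x) \<noteq> label Q x" if "x \<in> creases k" for x
    using l[OF crease_closed[OF that]] crease_involution[OF that] by simp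
  have "\<Pi> \<in> relabel \<phi> ` F P k" if "\<Pi> \<in> F Q k" for \<Pi>
    using order_valid_relabel[of Q \<Pi> P, OF _ l'] relabel_relabel[OF F_subset[OF that]] that assms(1,2)
    by (intro image_eqI[of _ _ "relabel \<phi> \<Pi>"]) (auto simp: F_eq)
  then show ?thesis
    using order_valid_relabel[of P _ Q, OF _ l] assms(1,2) by (auto simp: F_eq)
qed

lemma F_VVMMVV: "F (V, V, M, M, V, V) k = T_CR ` F MMMMVV k"
proof -
  have "label (V, V, M, M, V, V) (exchange_rows x) \<noteq> label MMMMVV x" for x
    by (cases x) auto
  then show ?thesis
    unfolding T_CR_def by (intro rows.F_relabel locally_flat_foldable_word) simp_all
qed

lemma F_VVVVMM: "F (V, V, V, V, M, M) k = T_C ` F MMMMVV k"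
proof -
  have "label (V, V, V, V, M, M) x \<noteq> label MMMMVV x" for x
    by (cases x) auto
  then show ?thesis
    by (intro F_T_C locally_flat_foldable_word) simp_all
qed

lemma F_VVVVMM_reflect: "F (V, V, V, V, M, M) k = T_CH k ` F MMMMVV k"
proof -
  have "label (V, V, V, V, M, M) (reflect_columns k x) \<noteq> label MMMMVV x" for x
    by (cases x) auto
  then show ?thesis
    unfolding T_CH_def by (intro columns.F_relabel locally_flat_foldable_word) simp_all
qed

lemma F_VMVVVV: "F (V, M, V, V, V, V) k = T_C ` F MVMMMM k"
proof -
  have "label (V, M, V, V, V, V) x \<noteq> label MVMMMM x" for x
    by (cases x) auto
  then show ?thesis
    by (intro F_T_C locally_flat_foldable_word) simp_all
qed

text \<open>Reflection exchanges odd and even hinge columns and inverts labels, so unequal hinge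
  labels are reproduced while the row labels change. The parity argument needs the columns in range,
  since subtraction is truncated.\<close>

lemma F_MVVVVV: "F (M, V, V, V, V, V) k = T_CH k ` F MVMMMM k"
proof -
  have "label (M, V, V, V, V, V) (reflect_columns k x) \<noteq> label MVMMMM x" if "x \<in> creases k" for x
    using that by (cases x) (auto simp: mod_2_eq_odd)
  then show ?thesis
    unfolding T_CH_def by (intro columns.F_relabel locally_flat_foldable_word) simp_all
qed

lemma T_R_eq: "T_R \<Pi> = T_C (T_CR \<Pi>)"
  by (simp add: T_R_def T_C_def T_CR_def)

lemma T_H_eq: "T_H k \<Pi> = T_C (T_CH k \<Pi>)"
  by (simp add: T_H_def T_C_def T_CH_def)

lemma F_MMVVMM: "F (M, M, V, V, M, M) k = T_R ` F MMMMVV k"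
proof -
  have "label (M, M, V, V, M, M) x \<noteq> label (V, V, M, M, V, V) x" for x
    by (cases x) auto
  then have "F (M, M, V, V, M, M) k = T_C ` F (V, V, M, M, V, V) k"
    by (intro F_T_C locally_flat_foldable_word) simp_all
  then show ?thesis
    by (simp add: F_VVMMVV T_R_eq image_image)
qed

lemma F_VMMMMM: "F (V, M, M, M, M, M) k = T_H k ` F MVMMMM k"
proof -
  have "label (V, M, M, M, M, M) x \<noteq> label (M, V, V, V, V, V) x" for x
    by (cases x) auto
  then have "F (V, M, M, M, M, M) k = T_C ` F (M, V, V, V, V, V) k"
    by (intro F_T_C locally_flat_foldable_word) simp_all
  then show ?thesis
    by (simp add: F_MVVVVV T_H_eq image_image)
qed

text \<open>With \<open>h\<^sub>0 = h\<^sub>1\<close> the exchange of hinge parities is invisible,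
  so \<open>MMMMVV\<close> is its own image under \<open>T_H\<close>. This is what produces the
  states with \<alpha> = 2k - 1 from those with \<alpha> = 1.\<close>

lemma F_MMMMVV_reflect: "F MMMMVV k = T_H k ` F MMMMVV k"
proof -
  have "F MMMMVV k = T_C ` F (V, V, V, V, M, M) k"
    by (simp add: F_VVVVMM image_image)
  then show ?thesis
    by (simp add: F_VVVVMM_reflect T_H_eq image_image)
qed

section \<open>Pivot pairs under the symmetries\<close>

lemma row_sorted_T_C: "row_sorted k row (T_C \<Pi>) f \<longleftrightarrow> row_sorted k row \<Pi> (\<lambda>c. - f c)"
  by (auto simp: row_sorted_def T_C_def)

lemma has_pivot_pair_T_C:
  assumes "\<alpha> \<in> {1..2 * k - 1}" and "\<beta> \<in> {1..2 * k - 1}"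
  shows "has_pivot_pair k (T_C \<Pi>) \<alpha> \<beta> \<longleftrightarrow> has_pivot_pair k \<Pi> \<alpha> \<beta>"
  using assms by (auto simp: has_pivot_pair_iff row_sorted_T_C)

lemma has_pivot_pair_T_CR:
  assumes "\<alpha> \<in> {1..2 * k - 1}" and "\<beta> \<in> {1..2 * k - 1}" and "\<Pi> \<subseteq> faces k \<times> faces k"
  shows "has_pivot_pair k (T_CR \<Pi>) \<alpha> \<beta> \<longleftrightarrow> has_pivot_pair k \<Pi> \<beta> \<alpha>"
proof -
  have "row_sorted k A (T_CR \<Pi>) f \<longleftrightarrow> row_sorted k B \<Pi> f"
    "row_sorted k B (T_CR \<Pi>) f \<longleftrightarrow> row_sorted k A \<Pi> f" for f
    unfolding row_sorted_def T_CR_def using assms(3) by (auto simp: rows.relabel_iff)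
  then show ?thesis
    using assms by (auto simp: has_pivot_pair_iff)
qed

text \<open>Reflection exchanges the two blocks and the two parities of columns while keeping the
  parity of the pivot, so it carries \<open>W\<^sub>p\<close> to the reversed word of pivot 2k -
  p.\<close>

lemma rank_reflect:
  assumes "p \<in> {1..2 * k - 1}" and "c \<in> {1..2 * k}" and "d \<in> {1..2 * k}"
  shows "rank k (2 * k - p) (2 * k + 1 - c) < rank k (2 * k - p) (2 * k + 1 - d) \<longleftrightarrow>
    rank k p d < rank k p c"
proof -
  define p' c' d' where "p' = 2 * k - p" and "c' = 2 * k + 1 - c" and "d' = 2 * k + 1 - d"
  have i: "int p' = 2 * int k - int p" "int c' = 2 * int k + 1 - int c" "int d' = 2 * int k + 1 - int d"
    using assms by (auto simp: p'_def c'_def d'_def)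
  have o: "odd p' \<longleftrightarrow> odd p" "odd c' \<longleftrightarrow> even c" "odd d' \<longleftrightarrow> even d"
    using assms by (auto simp: p'_def c'_def d'_def)
  have l: "c' \<le> p' \<longleftrightarrow> p < c" "d' \<le> p' \<longleftrightarrow> p < d"
    using assms by (auto simp: p'_def c'_def d'_def)
  show ?thesis
    unfolding p'_def[symmetric] c'_def[symmetric] d'_def[symmetric]
    using assms odd_less_double[of c k] odd_less_double[of d k]
    by (cases "odd c"; cases "odd d") (auto simp: rank_def i o l)
qed

lemma row_sorted_T_CH:
  assumes "\<Pi> \<subseteq> faces k \<times> faces k" and "row = A \<or> row = B"
  shows "row_sorted k row (T_CH k \<Pi>) f \<longleftrightarrow> row_sorted k row \<Pi> (\<lambda>c. f (2 * k + 1 - c))"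
proof -
  have iff: "(row c, row d) \<in> T_CH k \<Pi> \<longleftrightarrow> (row (2 * k + 1 - c), row (2 * k + 1 - d)) \<in> \<Pi>"
    if "c \<in> {1..2 * k}" "d \<in> {1..2 * k}" for c d
    unfolding T_CH_def using assms that by (auto simp: columns.relabel_iff)
  have r: "2 * k + 1 - c \<in> {1..2 * k}" "2 * k + 1 - (2 * k + 1 - c) = c" if "c \<in> {1..2 * k}" for c
    using that by auto
  show ?thesis
    unfolding row_sorted_def by (simp only: iff cong: ball_cong) (metis r)
qed

text \<open>Both rows get reversed words, which the definition of a pivot pair does not distinguish
  from the words themselves.\<close>

lemma has_pivot_pair_T_CH:
  assumes "\<alpha> \<in> {1..2 * k - 1}" and "\<beta> \<in> {1..2 * k - 1}" and "\<Pi> \<subseteq> faces k \<times> faces k"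
  shows "has_pivot_pair k (T_CH k \<Pi>) (2 * k - \<alpha>) (2 * k - \<beta>) \<longleftrightarrow> has_pivot_pair k \<Pi> \<alpha> \<beta>"
proof -
  have "row_sorted k row (T_CH k \<Pi>) (rank k (2 * k - p)) \<longleftrightarrow> row_sorted k row \<Pi> (\<lambda>c. - rank k p c)"
    "row_sorted k row (T_CH k \<Pi>) (\<lambda>c. - rank k (2 * k - p) c) \<longleftrightarrow> row_sorted k row \<Pi> (rank k p)"
    if "p \<in> {1..2 * k - 1}" "row = A \<or> row = B" for row p
    unfolding row_sorted_T_CH[OF assms(3) that(2)] unfolding row_sorted_def
    using rank_reflect[OF that(1)] by auto
  moreover have "2 * k - \<alpha> \<in> {1..2 * k - 1}" "2 * k - \<beta> \<in> {1..2 * k - 1}"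
    using assms by auto
  ultimately show ?thesis
    using assms by (auto simp: has_pivot_pair_iff)
qed

section \<open>Uniqueness\<close>

lemma face_order_eqI:
  assumes \<Pi>: "face_order k \<Pi>" and \<Pi>': "face_order k \<Pi>'"
    and A: "\<And>c d. c \<in> {1..2 * k} \<Longrightarrow> d \<in> {1..2 * k} \<Longrightarrow> (A c, A d) \<in> \<Pi> \<longleftrightarrow> (A c, A d) \<in> \<Pi>'"
    and B: "\<And>c d. c \<in> {1..2 * k} \<Longrightarrow> d \<in> {1..2 * k} \<Longrightarrow> (B c, B d) \<in> \<Pi> \<longleftrightarrow> (B c, B d) \<in> \<Pi>'"
    and AB: "\<And>c d. c \<in> {1..2 * k} \<Longrightarrow> d \<in> {1..2 * k} \<Longrightarrow> (A c, B d) \<in> \<Pi> \<longleftrightarrow> (A c, B d) \<in> \<Pi>'"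
  shows "\<Pi> = \<Pi>'"
proof -
  have opp: "(B d, A c) \<in> \<Phi> \<longleftrightarrow> (A c, B d) \<notin> \<Phi>"
    if "face_order k \<Phi>" "c \<in> {1..2 * k}" "d \<in> {1..2 * k}" for \<Phi> c d
  proof -
    have "(A c, B d) \<in> \<Phi> \<or> (B d, A c) \<in> \<Phi>"
      using that unfolding face_order_iff by auto
    moreover have "\<not> ((A c, B d) \<in> \<Phi> \<and> (B d, A c) \<in> \<Phi>)"
      using that(1) unfolding face_order_iff by (meson irreflD transD)
    ultimately show ?thesis by blast
  qed
  have "z \<in> \<Pi> \<longleftrightarrow> z \<in> \<Pi>'" for z
  proof (cases "z \<in> faces k \<times> faces k")
    case True
    then obtain f g where z: "z = (f, g)" "f \<in> faces k" "g \<in> faces k" by blast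
    show ?thesis
      using z(2,3) A B AB opp[OF \<Pi>] opp[OF \<Pi>'] unfolding z(1) by (cases f; cases g) auto
  next
    case False
    then show ?thesis using \<Pi> \<Pi>' unfolding face_order_def by blast
  qed
  then show ?thesis by blast
qed

locale state =
  fixes k :: nat and P :: word and \<Pi> :: "face rel"
  assumes valid: "order_valid P k \<Pi>"
begin

abbreviation above :: "face \<Rightarrow> face \<Rightarrow> bool" (infix "\<prec>" 50) where
  "f \<prec> g \<equiv> (f, g) \<in> \<Pi>"

lemma face_order: "face_order k \<Pi>"
  using valid by (rule order_valid_imp_face_order)

lemma above_trans [trans]: "f \<prec> g \<Longrightarrow> g \<prec> h \<Longrightarrow> f \<prec> h"
  using face_order unfolding face_order_iff by (meson transD)

lemma above_asym: "f \<prec> g \<Longrightarrow> \<not> g \<prec> f"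
  using face_order unfolding face_order_iff by (meson transD irreflD)

lemma above_total: "f \<in> faces k \<Longrightarrow> g \<in> faces k \<Longrightarrow> f \<noteq> g \<Longrightarrow> \<not> f \<prec> g \<Longrightarrow> g \<prec> f"
  using face_order unfolding face_order_iff by blast

lemma top_above_bottom: "x \<in> creases k \<Longrightarrow> top_wing P x \<prec> bottom_wing P x"
  using valid unfolding order_valid_iff[OF face_order] by blast

lemma not_crossing:
  assumes "x \<in> creases k" and "y \<in> creases k" and "x \<noteq> y" and "target_class x = target_class y"
    and "wings x \<inter> wings y = {}"
    and "top_wing P x \<prec> top_wing P y" and "top_wing P y \<prec> bottom_wing P x"
  shows "\<not> bottom_wing P x \<prec> bottom_wing P y"
  using valid assms unfolding order_valid_iff[OF face_order] by blast

end

locale state_MMMMVV = state k MMMMVV \<Pi> for k \<Pi>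
begin

lemma above_hinge:
  assumes "c \<in> {1..2 * k}"
  shows "odd c \<Longrightarrow> A c \<prec> B c" and "even c \<Longrightarrow> B c \<prec> A c"
  using top_above_bottom[of "H c"] assms by (simp_all add: wings_MMMMVV)

lemma above_adjacent:
  assumes "c \<in> {1..2 * k - 1}"
  shows "odd c \<Longrightarrow> A c \<prec> A (c + 1)" and "even c \<Longrightarrow> A (c + 1) \<prec> A c"
    and "odd c \<Longrightarrow> B c \<prec> B (c + 1)" and "even c \<Longrightarrow> B (c + 1) \<prec> B c"
  using top_above_bottom[of "U c"] top_above_bottom[of "L c"] assms by (simp_all add: wings_MMMMVV)

text \<open>\<open>A c\<close> reaches \<open>B d\<close> through \<open>A d\<close> or through
  \<open>B c\<close> unless both upper and lower faces of d come first. In that case the hinge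
  intervals may not overlap, so the hinge of d ends before that of c begins.\<close>

lemma above_odd_odd:
  assumes "c \<in> {1..2 * k}" and "d \<in> {1..2 * k}" and "odd c" and "odd d"
  shows "A c \<prec> B d \<longleftrightarrow> \<not> (A d \<prec> A c \<and> B d \<prec> B c)"
proof (cases "c = d")
  case True
  then show ?thesis using above_hinge(1)[OF assms(1,3)] above_asym by blast
next
  case False
  have "A c \<prec> B d" if "\<not> A d \<prec> A c"
    using above_total[of "A d" "A c"] that False assms above_hinge(1)[OF assms(2,4)] above_trans by auto
  moreover have "A c \<prec> B d" if "\<not> B d \<prec> B c"
    using above_total[of "B d" "B c"] that False assms above_hinge(1)[OF assms(1,3)] above_trans by auto
  moreover have "\<not> A c \<prec> B d" if "A d \<prec> A c" "B d \<prec> B c"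
    using not_crossing[of "H d" "H c"] that False assms by (auto simp: wings_MMMMVV)
  ultimately show ?thesis by blast
qed

text \<open>Even hinges begin at the lower face. If the hinge of c begins and ends before that of d,
  noncrossing makes them disjoint, and conversely disjointness in this order gives both
  comparisons.\<close>

lemma above_even_even:
  assumes "c \<in> {1..2 * k}" and "d \<in> {1..2 * k}" and "even c" and "even d"
  shows "A c \<prec> B d \<longleftrightarrow> A c \<prec> A d \<and> B c \<prec> B d"
proof (cases "c = d")
  case True
  then show ?thesis using above_hinge(2)[OF assms(1,3)] above_asym by blast
next
  case False
  have "A c \<prec> A d \<and> B c \<prec> B d" if "A c \<prec> B d"
    using that above_hinge(2)[OF assms(1,3)] above_hinge(2)[OF assms(2,4)] above_trans by blast
  moreover have "\<not> B d \<prec> A c" if "A c \<prec> A d" "B c \<prec> B d"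
    using not_crossing[of "H c" "H d"] that False assms by (auto simp: wings_MMMMVV)
  ultimately show ?thesis
    using above_total[of "B d" "A c"] assms by auto
qed

text \<open>The intervals of \<open>U c\<close> and \<open>L (d - 1)\<close> are both of class
  \<open>E\<close>. If \<open>A c\<close> lies strictly inside the second, then
  \<open>A (c + 1)\<close> does too; so the comparison reduces to columns of equal parity.\<close>

lemma above_odd_even:
  assumes "c \<in> {1..2 * k}" and "d \<in> {1..2 * k}" and "odd c" and "even d"
  shows "A c \<prec> B d \<longleftrightarrow> A c \<prec> B (d - 1) \<or> A (c + 1) \<prec> B d"
proof -
  have r: "c \<in> {1..2 * k - 1}" "d - 1 \<in> {1..2 * k - 1}" "odd (d - 1)" "d - 1 + 1 = d" "d - 1 \<in> {1..2 * k}"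
    using assms odd_less_double[of c k] by (auto elim!: evenE)
  have adj: "A c \<prec> A (c + 1)" "B (d - 1) \<prec> B d"
    using above_adjacent(1)[OF r(1) assms(3)] above_adjacent(3)[OF r(2,3)] r(4) by simp_all
  have "\<not> B d \<prec> A (c + 1)" if "A c \<prec> B d" "B (d - 1) \<prec> A c"
    using not_crossing[of "L (d - 1)" "U c"] that r assms by (auto simp: wings_MMMMVV)
  moreover have "B (d - 1) \<prec> A c" if "\<not> A c \<prec> B (d - 1)"
    using above_total[OF _ _ _ that] assms(1) r(5) by simp
  moreover have "B d \<prec> A (c + 1)" if "\<not> A (c + 1) \<prec> B d"
    using above_total[OF _ _ _ that] assms(2) r(1) by auto
  moreover have "A c \<prec> B d" if "A c \<prec> B (d - 1)"
    using that adj(2) by (rule above_trans)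
  moreover have "A c \<prec> B d" if "A (c + 1) \<prec> B d"
    using adj(1) that by (rule above_trans)
  ultimately show ?thesis by blast
qed

text \<open>The same reduction with the intervals of \<open>U (c - 1)\<close> and
  \<open>L d\<close>: if \<open>B d\<close> lies inside the first, \<open>B (d + 1)\<close> does
  too.\<close>

lemma above_even_odd:
  assumes "c \<in> {1..2 * k}" and "d \<in> {1..2 * k}" and "even c" and "odd d"
  shows "A c \<prec> B d \<longleftrightarrow> A (c - 1) \<prec> B d \<and> A c \<prec> B (d + 1)"
proof -
  have r: "d \<in> {1..2 * k - 1}" "c - 1 \<in> {1..2 * k - 1}" "odd (c - 1)" "c - 1 + 1 = c" "c - 1 \<in> {1..2 * k}"
    using assms odd_less_double[of d k] by (auto elim!: evenE)
  have adj: "B d \<prec> B (d + 1)" "A (c - 1) \<prec> A c"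
    using above_adjacent(3)[OF r(1) assms(4)] above_adjacent(1)[OF r(2,3)] r(4) by simp_all
  have "\<not> A c \<prec> B (d + 1)" if "B d \<prec> A c" "A (c - 1) \<prec> B d"
    using not_crossing[of "U (c - 1)" "L d"] that r assms by (auto simp: wings_MMMMVV)
  moreover have "B d \<prec> A c" if "\<not> A c \<prec> B d"
    using above_total[OF _ _ _ that] assms(1,2) by simp
  moreover have "A c \<prec> B (d + 1)" if "A c \<prec> B d"
    using that adj(1) by (rule above_trans)
  moreover have "A (c - 1) \<prec> B d" if "A c \<prec> B d"
    using adj(2) that by (rule above_trans)
  ultimately show ?thesis by blast
qed

end

lemma state_MMMMVV_unique:
  assumes "state_MMMMVV k \<Pi>" and "state_MMMMVV k \<Pi>'"
    and A: "\<And>c d. c \<in> {1..2 * k} \<Longrightarrow> d \<in> {1..2 * k} \<Longrightarrow> (A c, A d) \<in> \<Pi> \<longleftrightarrow> (A c, A d) \<in> \<Pi>'"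
    and B: "\<And>c d. c \<in> {1..2 * k} \<Longrightarrow> d \<in> {1..2 * k} \<Longrightarrow> (B c, B d) \<in> \<Pi> \<longleftrightarrow> (B c, B d) \<in> \<Pi>'"
  shows "\<Pi> = \<Pi>'"
proof -
  interpret \<Pi>: state_MMMMVV k \<Pi> by fact
  interpret \<Pi>': state_MMMMVV k \<Pi>' by fact
  have same: "(A c, B d) \<in> \<Pi> \<longleftrightarrow> (A c, B d) \<in> \<Pi>'"
    if "c \<in> {1..2 * k}" "d \<in> {1..2 * k}" "odd c \<longleftrightarrow> odd d" for c d
    using that A B \<Pi>.above_odd_odd \<Pi>'.above_odd_odd \<Pi>.above_even_even \<Pi>'.above_even_even
    by (cases "odd c") auto
  have "(A c, B d) \<in> \<Pi> \<longleftrightarrow> (A c, B d) \<in> \<Pi>'" if cd: "c \<in> {1..2 * k}" "d \<in> {1..2 * k}" for c d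
  proof (cases "odd c \<longleftrightarrow> odd d")
    case True
    then show ?thesis using same cd by blast
  next
    case diff: False
    show ?thesis
    proof (cases "odd c")
      case True
      then have *: "d - 1 \<in> {1..2 * k}" "c + 1 \<in> {1..2 * k}" "odd (d - 1)" "even (c + 1)" "even d"
        using cd diff odd_less_double[of c k] by (auto elim!: evenE)
      show ?thesis
        unfolding \<Pi>.above_odd_even[OF cd True *(5)] \<Pi>'.above_odd_even[OF cd True *(5)]
        using same[OF cd(1) *(1)] same[OF *(2) cd(2)] True * by blast
    next
      case False
      then have *: "c - 1 \<in> {1..2 * k}" "d + 1 \<in> {1..2 * k}" "odd (c - 1)" "even (d + 1)" "odd d" "even c"
        using cd diff odd_less_double[of d k] by (auto elim!: evenE)
      show ?thesis
        unfolding \<Pi>.above_even_odd[OF cd *(6,5)] \<Pi>'.above_even_odd[OF cd *(6,5)]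
        using same[OF *(1) cd(2)] same[OF cd(1) *(2)] False * by blast
    qed
  qed
  then show ?thesis
    using face_order_eqI[OF \<Pi>.face_order \<Pi>'.face_order A B] by blast
qed

locale state_MVMMMM = state k MVMMMM \<Pi> for k \<Pi>
begin

lemma above_hinge:
  assumes "c \<in> {1..2 * k}"
  shows "A c \<prec> B c"
  using top_above_bottom[of "H c"] assms by (simp add: wings_MVMMMM)

lemma above_adjacent:
  assumes "c \<in> {1..2 * k - 1}" and "odd c"
  shows "A c \<prec> A (c + 1)" and "B (c + 1) \<prec> B c"
  using top_above_bottom[of "U c"] top_above_bottom[of "L c"] assms by (simp_all add: wings_MVMMMM)

text \<open>All hinges begin at the upper face, so the argument for two odd columns of
  \<open>MMMMVV\<close> applies to any two columns, and no row creases enter.\<close>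

lemma above_iff:
  assumes "c \<in> {1..2 * k}" and "d \<in> {1..2 * k}"
  shows "A c \<prec> B d \<longleftrightarrow> \<not> (A d \<prec> A c \<and> B d \<prec> B c)"
proof (cases "c = d")
  case True
  then show ?thesis using above_hinge[OF assms(1)] above_asym by blast
next
  case False
  have "A c \<prec> B d" if "\<not> A d \<prec> A c"
    using above_total[of "A d" "A c"] that False assms above_hinge[OF assms(2)] above_trans by auto
  moreover have "A c \<prec> B d" if "\<not> B d \<prec> B c"
    using above_total[of "B d" "B c"] that False assms above_hinge[OF assms(1)] above_trans by auto
  moreover have "\<not> A c \<prec> B d" if "A d \<prec> A c" "B d \<prec> B c"
    using not_crossing[of "H d" "H c"] that False assms by (auto simp: wings_MVMMMM)
  ultimately show ?thesis by blast
qed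

end

lemma state_MVMMMM_unique:
  assumes "state_MVMMMM k \<Pi>" and "state_MVMMMM k \<Pi>'"
    and A: "\<And>c d. c \<in> {1..2 * k} \<Longrightarrow> d \<in> {1..2 * k} \<Longrightarrow> (A c, A d) \<in> \<Pi> \<longleftrightarrow> (A c, A d) \<in> \<Pi>'"
    and B: "\<And>c d. c \<in> {1..2 * k} \<Longrightarrow> d \<in> {1..2 * k} \<Longrightarrow> (B c, B d) \<in> \<Pi> \<longleftrightarrow> (B c, B d) \<in> \<Pi>'"
  shows "\<Pi> = \<Pi>'"
proof -
  interpret \<Pi>: state_MVMMMM k \<Pi> by fact
  interpret \<Pi>': state_MVMMMM k \<Pi>' by fact
  have "(A c, B d) \<in> \<Pi> \<longleftrightarrow> (A c, B d) \<in> \<Pi>'" if "c \<in> {1..2 * k}" "d \<in> {1..2 * k}" for c d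
    using that A B by (simp add: \<Pi>.above_iff \<Pi>'.above_iff)
  then show ?thesis
    using face_order_eqI[OF \<Pi>.face_order \<Pi>'.face_order A B] by blast
qed

section \<open>Compatible pivot pairs\<close>

text \<open>Column \<alpha> - 1 ends the block up to \<alpha>, and \<alpha> + 2 starts the block
  beyond it. Any other pivot either puts both columns into one block, where odd comes first, or
  separates them with an even pivot, where the block beyond comes first.\<close>

lemma rank_odd_pivot:
  assumes "odd \<alpha>" and "2 \<le> \<alpha>" and "\<alpha> + 2 \<le> 2 * k" and "\<beta> \<in> {1..2 * k - 1}"
    and "rank k \<beta> (\<alpha> - 1) < rank k \<beta> (\<alpha> + 2)"
  shows "\<alpha> = \<beta>"
proof -
  consider "\<beta> < \<alpha> - 1" | "\<beta> = \<alpha> - 1" | "\<beta> = \<alpha>" | "\<beta> = \<alpha> + 1" | "\<alpha> + 2 \<le> \<beta>" by linarith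
  then show ?thesis using assms by cases (auto simp: rank_def split: if_splits)
qed

text \<open>For even \<alpha> the block beyond the pivot comes first and ends with \<alpha> + 2,
  directly followed by \<alpha> - 1. A different pivot separating these columns is odd and has the
  blocks the other way round.\<close>

lemma rank_even_pivot:
  assumes "even \<alpha>" and "2 \<le> \<alpha>" and "\<alpha> + 2 \<le> 2 * k" and "\<beta> \<in> {1..2 * k - 1}"
    and "rank k \<beta> (\<alpha> + 2) < rank k \<beta> (\<alpha> - 1)"
  shows "\<alpha> = \<beta>"
proof -
  consider "\<beta> < \<alpha> - 1" | "\<beta> = \<alpha> - 1" | "\<beta> = \<alpha>" | "\<beta> = \<alpha> + 1" | "\<alpha> + 2 \<le> \<beta>" by linarith
  then show ?thesis using assms by cases (auto simp: rank_def split: if_splits)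
qed

context state_MMMMVV
begin

text \<open>Column 1 precedes column 2 in every word, so the crease between them, which has a
  prescribed direction in each row, decides between the word and its reversal.\<close>

lemma has_pivot_pair_iff_sorted:
  assumes \<alpha>: "\<alpha> \<in> {1..2 * k - 1}" and \<beta>: "\<beta> \<in> {1..2 * k - 1}"
  shows "has_pivot_pair k \<Pi> \<alpha> \<beta> \<longleftrightarrow> row_sorted k A \<Pi> (rank k \<alpha>) \<and> row_sorted k B \<Pi> (rank k \<beta>)"
proof -
  have r: "1 \<in> {1..2 * k - 1}" "1 \<in> {1..2 * k}" "1 + 1 \<in> {1..2 * k}" using \<alpha> by auto
  have "\<not> row_sorted k A \<Pi> (\<lambda>c. - rank k \<alpha> c)"
    using above_adjacent(1)[OF r(1)] rank_adjacent[OF \<alpha> r(1)] r(2,3) unfolding row_sorted_def by fastforce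
  moreover have "\<not> row_sorted k B \<Pi> (\<lambda>c. - rank k \<beta> c)"
    using above_adjacent(3)[OF r(1)] rank_adjacent[OF \<beta> r(1)] r(2,3) unfolding row_sorted_def by fastforce
  ultimately show ?thesis
    unfolding has_pivot_pair_iff[OF \<alpha> \<beta>] by blast
qed

lemma compatible:
  assumes \<alpha>: "\<alpha> \<in> {1..2 * k - 1}" and \<beta>: "\<beta> \<in> {1..2 * k - 1}" and "has_pivot_pair k \<Pi> \<alpha> \<beta>"
  shows "\<alpha> = 1 \<or> \<alpha> = 2 * k - 1 \<or> \<alpha> = \<beta>"
proof (rule ccontr)
  assume n: "\<not> ?thesis"
  have A: "A c \<prec> A d \<longleftrightarrow> rank k \<alpha> c < rank k \<alpha> d" and B: "B c \<prec> B d \<longleftrightarrow> rank k \<beta> c < rank k \<beta> d"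
    if "c \<in> {1..2 * k}" "d \<in> {1..2 * k}" for c d
    using assms(3) that unfolding has_pivot_pair_iff_sorted[OF \<alpha> \<beta>] row_sorted_def by blast+
  have inherit: "rank k \<beta> d < rank k \<beta> c"
    if "c \<in> {1..2 * k}" "d \<in> {1..2 * k}" "odd c" "even d" "rank k \<alpha> d < rank k \<alpha> c" for c d
  proof -
    have "B d \<prec> A d" using above_hinge(2) that by blast
    also have "A d \<prec> A c" using A that by blast
    also have "A c \<prec> B c" using above_hinge(1) that by blast
    finally show ?thesis using B that by blast
  qed
  show False
  proof (cases "odd \<alpha>")
    case True
    have "1 \<le> \<alpha>" "\<alpha> \<le> 2 * k - 1" "\<alpha> \<noteq> 2 * k - 1" using n \<alpha> by auto
    with True have r: "\<alpha> \<noteq> 2" "\<alpha> + 2 \<le> 2 * k"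
      by presburger+
    \<comment> \<open>The two columns meet at the junction of the blocks of
      \<open>W\<^sub>\<alpha>\<close>; both exist because \<alpha> is neither 1 nor 2k - 1.\<close>
    then have "rank k \<beta> (\<alpha> - 1) < rank k \<beta> (\<alpha> + 2)"
      using True n \<alpha> by (intro inherit) (auto simp: rank_def)
    then show False
      using rank_odd_pivot[OF True _ r(2) \<beta>] True r n \<alpha> by (cases "\<alpha> = 1") auto
  next
    case False
    have "1 \<le> \<alpha>" "\<alpha> \<le> 2 * k - 1" using \<alpha> by auto
    with False have r: "\<alpha> + 2 \<le> 2 * k" "2 \<le> \<alpha>" by presburger+
    then have "rank k \<beta> (\<alpha> + 2) < rank k \<beta> (\<alpha> - 1)"
      using False n \<alpha> by (intro inherit) (auto simp: rank_def)
    then show False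
      using rank_even_pivot[OF _ r(2,1) \<beta>] False n by auto
  qed
qed

end

text \<open>The word starts with p if p is odd and with p + 1 if p is even, in both cases with
  \<open>2 * (p div 2) + 1\<close>. The rivals compared here are odd, like the first column of
  another word.\<close>

lemma rank_first:
  assumes "p \<in> {1..2 * k - 1}" and "c \<le> 2 * k" and "odd c" and "c \<noteq> 2 * B_R p + 1"
  shows "rank k p (2 * B_R p + 1) < rank k p c"
  using assms odd_less_double[of c k] by (cases "odd p") (auto simp: rank_def B_R_def elim!: oddE evenE)

lemma first_column:
  assumes "p \<in> {1..2 * k - 1}"
  shows "2 * B_R p + 1 \<in> {1..2 * k - 1}"
proof -
  have "1 \<le> p" "p \<le> 2 * k - 1" using assms by auto
  then have "2 * (p div 2) + 1 \<le> 2 * k - 1" by presburger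
  then show ?thesis using assms by (auto simp: B_R_def)
qed

text \<open>The even columns beyond the pivot descend, so the right neighbour of the first column is
  the last of them.\<close>

lemma rank_last:
  assumes "p \<in> {1..2 * k - 1}" and "c \<le> 2 * k" and "even c" and "2 * B_R p + 2 < c"
  shows "rank k p c < rank k p (2 * B_R p + 2)"
  using assms by (cases "odd p") (auto simp: rank_def B_R_def elim!: oddE evenE split: if_splits)

context state_MVMMMM
begin

lemma has_pivot_pair_iff_sorted:
  assumes \<alpha>: "\<alpha> \<in> {1..2 * k - 1}" and \<beta>: "\<beta> \<in> {1..2 * k - 1}"
  shows "has_pivot_pair k \<Pi> \<alpha> \<beta> \<longleftrightarrow>
    row_sorted k A \<Pi> (rank k \<alpha>) \<and> row_sorted k B \<Pi> (\<lambda>c. - rank k \<beta> c)"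
proof -
  have r: "1 \<in> {1..2 * k - 1}" "1 \<in> {1..2 * k}" "1 + 1 \<in> {1..2 * k}" using \<alpha> by auto
  have "\<not> row_sorted k A \<Pi> (\<lambda>c. - rank k \<alpha> c)"
    using above_adjacent(1)[OF r(1)] rank_adjacent[OF \<alpha> r(1)] r(2,3) unfolding row_sorted_def by fastforce
  moreover have "\<not> row_sorted k B \<Pi> (rank k \<beta>)"
    using above_adjacent(2)[OF r(1)] rank_adjacent[OF \<beta> r(1)] r(2,3) unfolding row_sorted_def by fastforce
  ultimately show ?thesis
    unfolding has_pivot_pair_iff[OF \<alpha> \<beta>] by blast
qed

lemma compatible:
  assumes \<alpha>: "\<alpha> \<in> {1..2 * k - 1}" and \<beta>: "\<beta> \<in> {1..2 * k - 1}" and "has_pivot_pair k \<Pi> \<alpha> \<beta>"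
  shows "B_R \<alpha> = B_R \<beta>"
proof (rule ccontr)
  assume n: "B_R \<alpha> \<noteq> B_R \<beta>"
  have A: "A c \<prec> A d \<longleftrightarrow> rank k \<alpha> c < rank k \<alpha> d" and B: "B c \<prec> B d \<longleftrightarrow> rank k \<beta> d < rank k \<beta> c"
    if "c \<in> {1..2 * k}" "d \<in> {1..2 * k}" for c d
    using assms(3) that unfolding has_pivot_pair_iff_sorted[OF \<alpha> \<beta>] row_sorted_def by auto
  define c d where "c = 2 * B_R \<alpha> + 1" and "d = 2 * B_R \<beta> + 1"
  have r: "c \<in> {1..2 * k - 1}" "d \<in> {1..2 * k - 1}"
    using first_column[OF \<alpha>] first_column[OF \<beta>] by (auto simp: c_def d_def)
  then have r': "c \<in> {1..2 * k}" "d \<in> {1..2 * k}" "c + 1 \<in> {1..2 * k}" "d + 1 \<in> {1..2 * k}"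
    by auto
  have o: "odd c" "odd d" "c \<noteq> d" using n by (auto simp: c_def d_def)
  have "A c \<prec> A d"
    using rank_first[OF \<alpha>, of d] r' o A by (auto simp: c_def)
  moreover have "B c \<prec> B d"
    using rank_first[OF \<beta>, of c] r' o B by (auto simp: d_def)
  \<comment> \<open>The hinge of c both begins and ends before that of d: c is first in the upper
    word, d is last in the reversed lower word. Noncrossing therefore makes the two hinges
    disjoint.\<close>
  ultimately have "\<not> A d \<prec> B c"
    using above_iff[OF r'(2,1)] by blast
  then have "B c \<prec> A d"
    using above_total[of "A d" "B c"] r' by auto
  have "B (c + 1) \<prec> B c" using above_adjacent(2)[OF r(1) o(1)] .
  also note \<open>B c \<prec> A d\<close>
  also have "A d \<prec> A (d + 1)" using above_adjacent(1)[OF r(2) o(2)] .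
  finally have *: "B (c + 1) \<prec> A (d + 1)" .
  show False
  \<comment> \<open>The larger first column decides which row is violated: its right neighbour must
    precede that of the smaller one in the upper word, or follow it in the reversed lower
    word.\<close>
  proof (cases "c < d")
    case True
    have "A (c + 1) \<prec> A (d + 1)"
      using above_hinge[OF r'(3)] * by (rule above_trans)
    then show False
      using rank_last[OF \<alpha>, of "d + 1"] True o(2) r' A by (auto simp: c_def)
  next
    case False
    have "B (c + 1) \<prec> B (d + 1)"
      using * above_hinge[OF r'(4)] by (rule above_trans)
    then show False
      using rank_last[OF \<beta>, of "c + 1"] False o r' B by (auto simp: d_def)
  qed
qed

end

section \<open>Classification of pivot pairs and its transfer to all eight words\<close>

definition pivot_classification :: "nat \<Rightarrow> word \<Rightarrow> (nat \<Rightarrow> nat \<Rightarrow> bool) \<Rightarrow> bool" where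
  "pivot_classification k P R \<longleftrightarrow> (\<forall>\<alpha>\<in>{1..2 * k - 1}. \<forall>\<beta>\<in>{1..2 * k - 1}.
     ((\<exists>\<Pi>\<in>F P k. has_pivot_pair k \<Pi> \<alpha> \<beta>) \<longleftrightarrow> R \<alpha> \<beta>) \<and>
     (R \<alpha> \<beta> \<longrightarrow> (\<exists>!\<Pi>. \<Pi> \<in> F P k \<and> has_pivot_pair k \<Pi> \<alpha> \<beta>)))"

lemma pivot_classificationI:
  assumes "\<And>\<Pi> \<alpha> \<beta>. \<alpha> \<in> {1..2 * k - 1} \<Longrightarrow> \<beta> \<in> {1..2 * k - 1} \<Longrightarrow> \<Pi> \<in> F P k \<Longrightarrow>
      has_pivot_pair k \<Pi> \<alpha> \<beta> \<Longrightarrow> R \<alpha> \<beta>"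
    and "\<And>\<alpha> \<beta>. \<alpha> \<in> {1..2 * k - 1} \<Longrightarrow> \<beta> \<in> {1..2 * k - 1} \<Longrightarrow> R \<alpha> \<beta> \<Longrightarrow>
      \<exists>\<Pi>\<in>F P k. has_pivot_pair k \<Pi> \<alpha> \<beta>"
    and "\<And>\<Pi> \<Pi>' \<alpha> \<beta>. \<alpha> \<in> {1..2 * k - 1} \<Longrightarrow> \<beta> \<in> {1..2 * k - 1} \<Longrightarrow> \<Pi> \<in> F P k \<Longrightarrow> \<Pi>' \<in> F P k \<Longrightarrow>
      has_pivot_pair k \<Pi> \<alpha> \<beta> \<Longrightarrow> has_pivot_pair k \<Pi>' \<alpha> \<beta> \<Longrightarrow> \<Pi> = \<Pi>'"
  shows "pivot_classification k P R"
  unfolding pivot_classification_def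
proof (intro ballI conjI impI)
  fix \<alpha> \<beta> assume r: "\<alpha> \<in> {1..2 * k - 1}" "\<beta> \<in> {1..2 * k - 1}"
  show "(\<exists>\<Pi>\<in>F P k. has_pivot_pair k \<Pi> \<alpha> \<beta>) \<longleftrightarrow> R \<alpha> \<beta>"
    using assms(1,2)[OF r] by blast
  assume "R \<alpha> \<beta>"
  then show "\<exists>!\<Pi>. \<Pi> \<in> F P k \<and> has_pivot_pair k \<Pi> \<alpha> \<beta>"
    using assms(2,3)[OF r] by blast
qed

text \<open>The functions a and b pull pivots back: they give the pivot pair of the source state in
  terms of that of its image. Injectivity of T is not assumed to reach beyond the states of
  P.\<close>

lemma pivot_classification_image:
  assumes P: "pivot_classification k P R" and Q: "F Q k = T ` F P k" and inj: "inj_on T (F P k)"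
    and range: "\<And>\<alpha> \<beta>. \<alpha> \<in> {1..2 * k - 1} \<Longrightarrow> \<beta> \<in> {1..2 * k - 1} \<Longrightarrow>
      a \<alpha> \<beta> \<in> {1..2 * k - 1} \<and> b \<alpha> \<beta> \<in> {1..2 * k - 1}"
    and T: "\<And>\<Pi> \<alpha> \<beta>. \<alpha> \<in> {1..2 * k - 1} \<Longrightarrow> \<beta> \<in> {1..2 * k - 1} \<Longrightarrow> \<Pi> \<in> F P k \<Longrightarrow>
      has_pivot_pair k (T \<Pi>) \<alpha> \<beta> \<longleftrightarrow> has_pivot_pair k \<Pi> (a \<alpha> \<beta>) (b \<alpha> \<beta>)"
  shows "pivot_classification k Q (\<lambda>\<alpha> \<beta>. R (a \<alpha> \<beta>) (b \<alpha> \<beta>))"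
proof (rule pivot_classificationI)
  fix \<alpha> \<beta> assume r: "\<alpha> \<in> {1..2 * k - 1}" "\<beta> \<in> {1..2 * k - 1}"
  note P' = P[unfolded pivot_classification_def, rule_format, OF range[OF r, THEN conjunct1] range[OF r, THEN conjunct2]]
  show "R (a \<alpha> \<beta>) (b \<alpha> \<beta>)" if "\<Pi> \<in> F Q k" "has_pivot_pair k \<Pi> \<alpha> \<beta>" for \<Pi>
    using that P' T[OF r] unfolding Q by blast
  show "\<exists>\<Pi>\<in>F Q k. has_pivot_pair k \<Pi> \<alpha> \<beta>" if "R (a \<alpha> \<beta>) (b \<alpha> \<beta>)"
    using that P' T[OF r] unfolding Q by blast
  show "\<Pi> = \<Pi>'" if \<Pi>: "\<Pi> \<in> F Q k" "\<Pi>' \<in> F Q k" "has_pivot_pair k \<Pi> \<alpha> \<beta>" "has_pivot_pair k \<Pi>' \<alpha> \<beta>" for \<Pi> \<Pi>'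
  proof -
    obtain \<Phi> \<Phi>' where \<Phi>: "\<Phi> \<in> F P k" "\<Pi> = T \<Phi>" "\<Phi>' \<in> F P k" "\<Pi>' = T \<Phi>'"
      using \<Pi>(1,2) unfolding Q by blast
    then have "has_pivot_pair k \<Phi> (a \<alpha> \<beta>) (b \<alpha> \<beta>)" "has_pivot_pair k \<Phi>' (a \<alpha> \<beta>) (b \<alpha> \<beta>)"
      using \<Pi> T[OF r] by auto
    then have "\<Phi> = \<Phi>'" using P' \<Phi> by blast
    then show ?thesis using \<Phi> by simp
  qed
qed

lemma state_MMMMVV_iff: "\<Pi> \<in> F MMMMVV k \<longleftrightarrow> state_MMMMVV k \<Pi>"
  by (simp add: F_eq locally_flat_foldable_word state_MMMMVV_def state_def)

lemma state_MVMMMM_iff: "\<Pi> \<in> F MVMMMM k \<longleftrightarrow> state_MVMMMM k \<Pi>"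
  by (simp add: F_eq locally_flat_foldable_word state_MVMMMM_def state_def)

lemma pivot_classification_MMMMVV:
  "pivot_classification k MMMMVV (\<lambda>\<alpha> \<beta>. \<alpha> = 1 \<or> \<alpha> = 2 * k - 1 \<or> \<alpha> = \<beta>)"
proof (rule pivot_classificationI)
  fix \<alpha> \<beta> assume r: "\<alpha> \<in> {1..2 * k - 1}" "\<beta> \<in> {1..2 * k - 1}"
  show "\<alpha> = 1 \<or> \<alpha> = 2 * k - 1 \<or> \<alpha> = \<beta>" if "\<Pi> \<in> F MMMMVV k" "has_pivot_pair k \<Pi> \<alpha> \<beta>" for \<Pi>
    using state_MMMMVV.compatible[OF _ r that(2)] that(1) by (simp add: state_MMMMVV_iff)
  show "\<exists>\<Pi>\<in>F MMMMVV k. has_pivot_pair k \<Pi> \<alpha> \<beta>" if "\<alpha> = 1 \<or> \<alpha> = 2 * k - 1 \<or> \<alpha> = \<beta>"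
    using that
  proof (elim disjE)
    assume "\<alpha> = 2 * k - 1"
    \<comment> \<open>The state is the image under \<open>T_H\<close> of the one with pivots 1 and
      2k - \<beta>.\<close>
    have r': "1 \<in> {1..2 * k - 1}" "2 * k - \<beta> \<in> {1..2 * k - 1}" "2 * k - (2 * k - \<beta>) = \<beta>"
      using r by auto
    obtain \<Pi> where \<Pi>: "\<Pi> \<in> F MMMMVV k" "has_pivot_pair k \<Pi> 1 (2 * k - \<beta>)"
      using outer_MMMMVV[OF r'(2)] by blast
    then have "has_pivot_pair k (T_H k \<Pi>) \<alpha> \<beta>"
      using has_pivot_pair_T_CH[OF r'(1,2) F_subset[OF \<Pi>(1)]] r r'(3) \<open>\<alpha> = 2 * k - 1\<close>
      by (simp add: T_H_eq has_pivot_pair_T_C)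
    then show ?thesis
      using F_MMMMVV_reflect[of k] \<Pi>(1) by blast
  qed (use r nested_MMMMVV outer_MMMMVV in auto)
  show "\<Pi> = \<Pi>'" if "\<Pi> \<in> F MMMMVV k" "\<Pi>' \<in> F MMMMVV k"
    "has_pivot_pair k \<Pi> \<alpha> \<beta>" "has_pivot_pair k \<Pi>' \<alpha> \<beta>" for \<Pi> \<Pi>'
  proof -
    have s: "state_MMMMVV k \<Pi>" "state_MMMMVV k \<Pi>'" using that by (simp_all add: state_MMMMVV_iff)
    show ?thesis
      using that(3,4) unfolding state_MMMMVV.has_pivot_pair_iff_sorted[OF s(1) r]
        state_MMMMVV.has_pivot_pair_iff_sorted[OF s(2) r] row_sorted_def
      by (intro state_MMMMVV_unique[OF s]) simp_all
  qed
qed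

text \<open>The classes of \<open>B_R\<close> on positive pivots are the singleton of 1 and the
  pairs 2s, 2s + 1 with s \<ge> 1. The three cases correspond to \<open>mirror_key\<close>,
  \<open>up_key\<close> and \<open>down_key\<close>.\<close>

lemma B_R_eq_cases:
  assumes "B_R p = B_R q" and "p \<noteq> 0" and "q \<noteq> 0"
  obtains "p = q" | "even p" "q = p + 1" | "odd p" "p \<ge> 2" "q = p - 1"
proof (cases "p = 1 \<or> q = 1")
  case True
  then show ?thesis using assms that by (auto simp: B_R_def split: if_splits)
next
  case False
  then have "p div 2 = q div 2" using assms by (auto simp: B_R_def)
  then show ?thesis using assms that False by (cases "odd p"; cases "odd q") (auto elim!: oddE evenE)
qed

lemma pivot_classification_MVMMMM:
  "pivot_classification k MVMMMM (\<lambda>\<alpha> \<beta>. B_R \<alpha> = B_R \<beta>)"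
proof (rule pivot_classificationI)
  fix \<alpha> \<beta> assume r: "\<alpha> \<in> {1..2 * k - 1}" "\<beta> \<in> {1..2 * k - 1}"
  show "B_R \<alpha> = B_R \<beta>" if "\<Pi> \<in> F MVMMMM k" "has_pivot_pair k \<Pi> \<alpha> \<beta>" for \<Pi>
    using state_MVMMMM.compatible[OF _ r that(2)] that(1) by (simp add: state_MVMMMM_iff)
  show "\<exists>\<Pi>\<in>F MVMMMM k. has_pivot_pair k \<Pi> \<alpha> \<beta>" if "B_R \<alpha> = B_R \<beta>"
    using that
  proof (rule B_R_eq_cases)
    assume "even \<alpha>" "\<beta> = \<alpha> + 1"
    then show ?thesis using up_MVMMMM[of \<alpha> k] r by auto
  next
    assume "odd \<alpha>" "\<alpha> \<ge> 2" "\<beta> = \<alpha> - 1"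
    then show ?thesis using down_MVMMMM[of \<alpha> k] r by auto
  qed (use r mirror_MVMMMM in auto)
  show "\<Pi> = \<Pi>'" if "\<Pi> \<in> F MVMMMM k" "\<Pi>' \<in> F MVMMMM k"
    "has_pivot_pair k \<Pi> \<alpha> \<beta>" "has_pivot_pair k \<Pi>' \<alpha> \<beta>" for \<Pi> \<Pi>'
  proof -
    have s: "state_MVMMMM k \<Pi>" "state_MVMMMM k \<Pi>'" using that by (simp_all add: state_MVMMMM_iff)
    show ?thesis
      using that(3,4) unfolding state_MVMMMM.has_pivot_pair_iff_sorted[OF s(1) r]
        state_MVMMMM.has_pivot_pair_iff_sorted[OF s(2) r] row_sorted_def
      by (intro state_MVMMMM_unique[OF s]) simp_all
  qed
qed

lemma inj_T_C: "inj T_C"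
  by (metis T_C_T_C injI)

lemma inj_on_T_CR: "inj_on T_CR (F P k)"
  unfolding T_CR_def by (metis F_subset rows.relabel_relabel inj_onI)

lemma inj_on_T_CH: "inj_on (T_CH k) (F P k)"
  unfolding T_CH_def by (metis F_subset columns.relabel_relabel inj_onI)

lemma inj_on_T_R: "inj_on T_R (F P k)"
  using comp_inj_on[OF inj_on_T_CR[of P k] inj_on_subset[OF inj_T_C]] by (simp add: comp_def T_R_eq[abs_def])

lemma inj_on_T_H: "inj_on (T_H k) (F P k)"
  using comp_inj_on[OF inj_on_T_CH[of k P] inj_on_subset[OF inj_T_C]] by (simp add: comp_def T_H_eq[abs_def])

lemma has_pivot_pair_T_CH':
  assumes "\<alpha> \<in> {1..2 * k - 1}" and "\<beta> \<in> {1..2 * k - 1}" and "\<Pi> \<subseteq> faces k \<times> faces k"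
  shows "has_pivot_pair k (T_CH k \<Pi>) \<alpha> \<beta> \<longleftrightarrow> has_pivot_pair k \<Pi> (2 * k - \<alpha>) (2 * k - \<beta>)"
proof -
  have "2 * k - \<alpha> \<in> {1..2 * k - 1}" "2 * k - \<beta> \<in> {1..2 * k - 1}"
    "2 * k - (2 * k - \<alpha>) = \<alpha>" "2 * k - (2 * k - \<beta>) = \<beta>"
    using assms by auto
  then show ?thesis
    using has_pivot_pair_T_CH[of "2 * k - \<alpha>" k "2 * k - \<beta>"] assms(3) by simp
qed

lemmas transfer_defs = has_pivot_pair_T_C has_pivot_pair_T_CR has_pivot_pair_T_CH' T_R_eq T_H_eq F_subset

lemma pivot_classification_VVVVMM:
  "pivot_classification k (V, V, V, V, M, M) (\<lambda>\<alpha> \<beta>. \<alpha> = 1 \<or> \<alpha> = 2 * k - 1 \<or> \<alpha> = \<beta>)"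
  using pivot_classification_image[OF pivot_classification_MMMMVV F_VVVVMM inj_on_subset[OF inj_T_C],
      where a = "\<lambda>\<alpha> \<beta>. \<alpha>" and b = "\<lambda>\<alpha> \<beta>. \<beta>"]
  by (simp add: transfer_defs)

lemma pivot_classification_VVMMVV:
  "pivot_classification k (V, V, M, M, V, V) (\<lambda>\<alpha> \<beta>. \<beta> = 1 \<or> \<beta> = 2 * k - 1 \<or> \<beta> = \<alpha>)"
  using pivot_classification_image[OF pivot_classification_MMMMVV F_VVMMVV inj_on_T_CR,
      where a = "\<lambda>\<alpha> \<beta>. \<beta>" and b = "\<lambda>\<alpha> \<beta>. \<alpha>"]
  by (simp add: transfer_defs)

lemma pivot_classification_MMVVMM:
  "pivot_classification k (M, M, V, V, M, M) (\<lambda>\<alpha> \<beta>. \<beta> = 1 \<or> \<beta> = 2 * k - 1 \<or> \<beta> = \<alpha>)"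
  using pivot_classification_image[OF pivot_classification_MMMMVV F_MMVVMM inj_on_T_R,
      where a = "\<lambda>\<alpha> \<beta>. \<beta>" and b = "\<lambda>\<alpha> \<beta>. \<alpha>"]
  by (simp add: transfer_defs)

lemma pivot_classification_VMVVVV:
  "pivot_classification k (V, M, V, V, V, V) (\<lambda>\<alpha> \<beta>. B_R \<alpha> = B_R \<beta>)"
  using pivot_classification_image[OF pivot_classification_MVMMMM F_VMVVVV inj_on_subset[OF inj_T_C],
      where a = "\<lambda>\<alpha> \<beta>. \<alpha>" and b = "\<lambda>\<alpha> \<beta>. \<beta>"]
  by (simp add: transfer_defs)

lemma pivot_classification_MVVVVV:
  "pivot_classification k (M, V, V, V, V, V) (\<lambda>\<alpha> \<beta>. B_L k \<alpha> = B_L k \<beta>)"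
  unfolding B_L_def
  by (rule pivot_classification_image[OF pivot_classification_MVMMMM F_MVVVVV inj_on_T_CH,
      where a = "\<lambda>\<alpha> \<beta>. 2 * k - \<alpha>" and b = "\<lambda>\<alpha> \<beta>. 2 * k - \<beta>"]) (auto simp: transfer_defs)

lemma pivot_classification_VMMMMM:
  "pivot_classification k (V, M, M, M, M, M) (\<lambda>\<alpha> \<beta>. B_L k \<alpha> = B_L k \<beta>)"
  unfolding B_L_def
  by (rule pivot_classification_image[OF pivot_classification_MVMMMM F_VMMMMM inj_on_T_H,
      where a = "\<lambda>\<alpha> \<beta>. 2 * k - \<alpha>" and b = "\<lambda>\<alpha> \<beta>. 2 * k - \<beta>"]) (auto simp: transfer_defs)

section \<open>Enumeration of the words with the prescribed signs\<close>

lemma words_rho_1: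
  "{P. delta0 P = - 1 \<and> delta1 P = - 1 \<and> tau P = 1 \<and> rho P = 1} =
    {(M, M, M, M, V, V), (M, M, V, V, M, M), (V, V, M, M, V, V), (V, V, V, V, M, M)}"
proof (intro set_eqI)
  fix P :: word
  obtain h0 h1 u0 u1 l0 l1 where "P = (h0, h1, u0, u1, l0, l1)" by (cases P)
  then show "P \<in> {P. delta0 P = - 1 \<and> delta1 P = - 1 \<and> tau P = 1 \<and> rho P = 1} \<longleftrightarrow>
    P \<in> {(M, M, M, M, V, V), (M, M, V, V, M, M), (V, V, M, M, V, V), (V, V, V, V, M, M)}"
    by (cases h0; cases h1; cases u0; cases u1; cases l0; cases l1; simp)
qed

lemma words_rho_minus_1:
  "{P. delta0 P = - 1 \<and> delta1 P = - 1 \<and> tau P = 1 \<and> rho P = - 1} =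
    {(M, V, M, M, M, M), (V, M, M, M, M, M), (V, M, V, V, V, V), (M, V, V, V, V, V)}"
proof (intro set_eqI)
  fix P :: word
  obtain h0 h1 u0 u1 l0 l1 where "P = (h0, h1, u0, u1, l0, l1)" by (cases P)
  then show "P \<in> {P. delta0 P = - 1 \<and> delta1 P = - 1 \<and> tau P = 1 \<and> rho P = - 1} \<longleftrightarrow>
    P \<in> {(M, V, M, M, M, M), (V, M, M, M, M, M), (V, M, V, V, V, V), (M, V, V, V, V, V)}"
    by (cases h0; cases h1; cases u0; cases u1; cases l0; cases l1; simp)
qed

lemma pivots_T_R:
  assumes "\<Pi> \<in> F P k" and "a \<in> {1..2 * k - 1}" and "b \<in> {1..2 * k - 1}" and "has_pivot_pair k \<Pi> a b"
  shows "has_pivot_pair k (T_R \<Pi>) b a" and "has_pivot_pair k (T_CR \<Pi>) b a"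
  using assms by (simp_all add: transfer_defs)

lemma pivots_T_H:
  assumes "\<Pi> \<in> F P k" and "a \<in> {1..2 * k - 1}" and "b \<in> {1..2 * k - 1}" and "has_pivot_pair k \<Pi> a b"
  shows "has_pivot_pair k (T_H k \<Pi>) (2 * k - a) (2 * k - b)"
    and "has_pivot_pair k (T_CH k \<Pi>) (2 * k - a) (2 * k - b)"
proof -
  have "2 * k - a \<in> {1..2 * k - 1}" "2 * k - b \<in> {1..2 * k - 1}"
    using assms(2,3) by auto
  then show "has_pivot_pair k (T_H k \<Pi>) (2 * k - a) (2 * k - b)"
    "has_pivot_pair k (T_CH k \<Pi>) (2 * k - a) (2 * k - b)"
    using has_pivot_pair_T_CH[OF assms(2,3) F_subset[OF assms(1)]] assms(4)
    by (simp_all add: T_H_eq has_pivot_pair_T_C)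
qed

theorem proposition8p1:
  fixes k n m :: nat
  assumes "k \<ge> 2" and "n = 2 * k" and "m = 2 * k - 1"
  shows
    "({P. delta0 P = - 1 \<and> delta1 P = - 1 \<and> tau P = 1 \<and> rho P = 1} =
          {(M, M, M, M, V, V), (M, M, V, V, M, M), (V, V, M, M, V, V), (V, V, V, V, M, M)} \<and>
        F (M, M, V, V, M, M) k = T_R ` F (M, M, M, M, V, V) k \<and>
        F (V, V, M, M, V, V) k = T_CR ` F (M, M, M, M, V, V) k \<and>
        F (V, V, V, V, M, M) k = T_C ` F (M, M, M, M, V, V) k \<and>
        (\<forall>P\<in>{(M, M, M, M, V, V), (V, V, V, V, M, M)}. \<forall>\<alpha>\<in>{1..m}. \<forall>\<beta>\<in>{1..m}.
            ((\<exists>\<Pi>\<in>F P k. has_pivot_pair k \<Pi> \<alpha> \<beta>) \<longleftrightarrow> (\<alpha> = 1 \<or> \<alpha> = m \<or> \<alpha> = \<beta>)) \<and>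
            ((\<alpha> = 1 \<or> \<alpha> = m \<or> \<alpha> = \<beta>) \<longrightarrow> (\<exists>!\<Pi>. \<Pi> \<in> F P k \<and> has_pivot_pair k \<Pi> \<alpha> \<beta>))) \<and>
        (\<forall>P\<in>{(M, M, V, V, M, M), (V, V, M, M, V, V)}. \<forall>\<alpha>\<in>{1..m}. \<forall>\<beta>\<in>{1..m}.
            ((\<exists>\<Pi>\<in>F P k. has_pivot_pair k \<Pi> \<alpha> \<beta>) \<longleftrightarrow> (\<beta> = 1 \<or> \<beta> = m \<or> \<alpha> = \<beta>)) \<and>
            ((\<beta> = 1 \<or> \<beta> = m \<or> \<alpha> = \<beta>) \<longrightarrow> (\<exists>!\<Pi>. \<Pi> \<in> F P k \<and> has_pivot_pair k \<Pi> \<alpha> \<beta>))) \<and>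
        (\<forall>\<Pi>\<in>F (M, M, M, M, V, V) k. \<forall>a\<in>{1..m}. \<forall>b\<in>{1..m}. has_pivot_pair k \<Pi> a b \<longrightarrow>
            has_pivot_pair k (T_R \<Pi>) b a \<and> has_pivot_pair k (T_CR \<Pi>) b a))
     \<and>
       ({P. delta0 P = - 1 \<and> delta1 P = - 1 \<and> tau P = 1 \<and> rho P = - 1} =
          {(M, V, M, M, M, M), (V, M, M, M, M, M), (V, M, V, V, V, V), (M, V, V, V, V, V)} \<and>
        F (V, M, M, M, M, M) k = T_H k ` F (M, V, M, M, M, M) k \<and>
        F (V, M, V, V, V, V) k = T_C ` F (M, V, M, M, M, M) k \<and>
        F (M, V, V, V, V, V) k = T_CH k ` F (M, V, M, M, M, M) k \<and>
        (\<forall>P\<in>{(M, V, M, M, M, M), (V, M, V, V, V, V)}. \<forall>\<alpha>\<in>{1..m}. \<forall>\<beta>\<in>{1..m}.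
            ((\<exists>\<Pi>\<in>F P k. has_pivot_pair k \<Pi> \<alpha> \<beta>) \<longleftrightarrow> (B_R \<alpha> = B_R \<beta>)) \<and>
            ((B_R \<alpha> = B_R \<beta>) \<longrightarrow> (\<exists>!\<Pi>. \<Pi> \<in> F P k \<and> has_pivot_pair k \<Pi> \<alpha> \<beta>))) \<and>
        (\<forall>P\<in>{(V, M, M, M, M, M), (M, V, V, V, V, V)}. \<forall>\<alpha>\<in>{1..m}. \<forall>\<beta>\<in>{1..m}.
            ((\<exists>\<Pi>\<in>F P k. has_pivot_pair k \<Pi> \<alpha> \<beta>) \<longleftrightarrow> (B_L k \<alpha> = B_L k \<beta>)) \<and>
            ((B_L k \<alpha> = B_L k \<beta>) \<longrightarrow> (\<exists>!\<Pi>. \<Pi> \<in> F P k \<and> has_pivot_pair k \<Pi> \<alpha> \<beta>))) \<and>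
        (\<forall>\<Pi>\<in>F (M, V, M, M, M, M) k. \<forall>a\<in>{1..m}. \<forall>b\<in>{1..m}. has_pivot_pair k \<Pi> a b \<longrightarrow>
            has_pivot_pair k (T_H k \<Pi>) (n - a) (n - b) \<and> has_pivot_pair k (T_CH k \<Pi>) (n - a) (n - b)))"
proof -
  have m: "m = 2 * k - 1" "n = 2 * k" by fact+
  have i: "\<forall>P\<in>{(M, M, M, M, V, V), (V, V, V, V, M, M)}.
      pivot_classification k P (\<lambda>\<alpha> \<beta>. \<alpha> = 1 \<or> \<alpha> = 2 * k - 1 \<or> \<alpha> = \<beta>)"
    "\<forall>P\<in>{(M, M, V, V, M, M), (V, V, M, M, V, V)}.
      pivot_classification k P (\<lambda>\<alpha> \<beta>. \<beta> = 1 \<or> \<beta> = 2 * k - 1 \<or> \<alpha> = \<beta>)"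
    using pivot_classification_MMMMVV pivot_classification_VVVVMM
      pivot_classification_MMVVMM pivot_classification_VVMMVV by (simp_all add: eq_commute)
  have ii: "\<forall>P\<in>{(M, V, M, M, M, M), (V, M, V, V, V, V)}.
      pivot_classification k P (\<lambda>\<alpha> \<beta>. B_R \<alpha> = B_R \<beta>)"
    "\<forall>P\<in>{(V, M, M, M, M, M), (M, V, V, V, V, V)}.
      pivot_classification k P (\<lambda>\<alpha> \<beta>. B_L k \<alpha> = B_L k \<beta>)"
    using pivot_classification_MVMMMM pivot_classification_VMVVVV
      pivot_classification_VMMMMM pivot_classification_MVVVVV by simp_all
  have T: "\<forall>\<Pi>\<in>F (M, M, M, M, V, V) k. \<forall>a\<in>{1..2 * k - 1}. \<forall>b\<in>{1..2 * k - 1}. has_pivot_pair k \<Pi> a b \<longrightarrow>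
      has_pivot_pair k (T_R \<Pi>) b a \<and> has_pivot_pair k (T_CR \<Pi>) b a"
    "\<forall>\<Pi>\<in>F (M, V, M, M, M, M) k. \<forall>a\<in>{1..2 * k - 1}. \<forall>b\<in>{1..2 * k - 1}. has_pivot_pair k \<Pi> a b \<longrightarrow>
      has_pivot_pair k (T_H k \<Pi>) (2 * k - a) (2 * k - b) \<and> has_pivot_pair k (T_CH k \<Pi>) (2 * k - a) (2 * k - b)"
    using pivots_T_R pivots_T_H by blast+
  show ?thesis
    unfolding m
    by (intro conjI words_rho_1 words_rho_minus_1 F_MMVVMM F_VVMMVV F_VVVVMM F_VMMMMM F_VMVVVV F_MVVVVV
        i[unfolded pivot_classification_def] ii[unfolded pivot_classification_def] T)
qed

end
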